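(* Let $\mathcal{A}=M_{n_1}\oplus\cdots\oplus M_{n_d}$, viewed as the block-diagonal subalgebra of $M_m$ with $m=n_1+\cdots+n_d$, and let $\tau$ be a completely positive map on $\mathcal{A}$ with $r(\tau)>0$. Then the canonical extension of the maximal part of $\tau$ equals the maximal part of the canonical extension of $\tau$: $\widetilde{\widehat{\tau}}=\widehat{\widetilde{\tau}}$. Moreover, for any Choi-Kraus decompositions $\widetilde{\tau}(X)=\sum_{i=1}^pA_i^*XA_i$ and $\widetilde{\widehat{\tau}}(X)=\sum_{j=1}^qB_j^*XB_j$ ($X\in M_m$), the vector space $\mathrm{span}\{B_1,\dots,B_q\}$ is a subalgebra of $M_m$ and is a non-zero ideal in the algebra generated by $A_1,\dots,A_p$.
   Context: $r(\tau)$ is the spectral radius. The canonical extension of a map $\sigma$ on $\mathcal{A}$ is $\widetilde{\sigma}=\iota\circ\sigma\circ\phi$, with $\iota:\mathcal{A}\hookrightarrow M_m$ the block-diagonal embedding and $\phi:M_m\to\mathcal{A}$ taking a block matrix to its block-diagonal part. For a positive map $\varphi$ on a finite dimensional $C^*$-algebra with $r(\varphi)>0$, its maximal part is $\widehat{\varphi}=\lim_{N\to\infty}\frac1N\sum_{n=1}^N\varphi^n/\|\varphi^n\|_\beta$, where $\beta$ is a Jordan basis of $\varphi$ and $\|\psi\|_\beta$ is the maximum modulus of the entries of the matrix of $\psi$ in $\beta$ (the limit exists, is independent of $\beta$, and is completely positive when $\varphi$ is). *)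

theory Defs
  imports Complex_Main "Jordan_Normal_Form.Jordan_Normal_Form" "Jordan_Normal_Form.Schur_Decomposition"
begin

definition lincomb :: "nat \<Rightarrow> complex list \<Rightarrow> complex mat list \<Rightarrow> complex mat" where
  "lincomb m cs Xs = foldr (\<lambda>(c,X) acc. c \<cdot>\<^sub>m X + acc) (zip cs Xs) (0\<^sub>m m m)"

definition mspan :: "nat \<Rightarrow> complex mat list \<Rightarrow> complex mat set" where
  "mspan m Xs = {lincomb m cs Xs | cs. length cs = length Xs}"

definition lin_indep :: "nat \<Rightarrow> complex mat list \<Rightarrow> bool" where
  "lin_indep m Xs \<longleftrightarrow> (\<forall>cs. length cs = length Xs \<longrightarrow> lincomb m cs Xs = 0\<^sub>m m m \<longrightarrow> set cs \<subseteq> {0})"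

definition is_basis :: "nat \<Rightarrow> complex mat set \<Rightarrow> complex mat list \<Rightarrow> bool" where
  "is_basis m V \<beta> \<longleftrightarrow> set \<beta> \<subseteq> carrier_mat m m \<and> lin_indep m \<beta> \<and> mspan m \<beta> = V"

definition coords :: "nat \<Rightarrow> complex mat list \<Rightarrow> complex mat \<Rightarrow> complex list" where
  "coords m \<beta> X = (THE cs. length cs = length \<beta> \<and> X = lincomb m cs \<beta>)"

definition map_mat :: "nat \<Rightarrow> complex mat list \<Rightarrow> (complex mat \<Rightarrow> complex mat) \<Rightarrow> complex mat" where
  "map_mat m \<beta> \<psi> = mat (length \<beta>) (length \<beta>) (\<lambda>(i,j). coords m \<beta> (\<psi> (\<beta> ! j)) ! i)"

definition jordan_basis :: "nat \<Rightarrow> complex mat set \<Rightarrow> (complex mat \<Rightarrow> complex mat) \<Rightarrow> complex mat list \<Rightarrow> bool" where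
  "jordan_basis m V \<phi> \<beta> \<longleftrightarrow> is_basis m V \<beta> \<and> (\<exists>n_as. map_mat m \<beta> \<phi> = jordan_matrix n_as)"

definition beta_norm :: "nat \<Rightarrow> complex mat list \<Rightarrow> (complex mat \<Rightarrow> complex mat) \<Rightarrow> real" where
  "beta_norm m \<beta> \<psi> = Max {cmod (map_mat m \<beta> \<psi> $$ (i,j)) | i j. i < length \<beta> \<and> j < length \<beta>}"

text \<open>maximal part of phi on the subspace V of M_m: the (pointwise, entrywise) limit of
  (1/N) sum_{n=1}^N phi^n / norm_beta(phi^n), for every Jordan basis beta of phi;
  values outside V are normalised to 0.\<close>
definition maximal_part :: "nat \<Rightarrow> complex mat set \<Rightarrow> (complex mat \<Rightarrow> complex mat) \<Rightarrow> (complex mat \<Rightarrow> complex mat)" where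
  "maximal_part m V \<phi> = (THE \<psi>.
      (\<forall>X. X \<notin> V \<longrightarrow> \<psi> X = 0\<^sub>m m m) \<and>
      (\<forall>X\<in>V. \<psi> X \<in> carrier_mat m m) \<and>
      (\<forall>\<beta>. jordan_basis m V \<phi> \<beta> \<longrightarrow>
         (\<forall>X\<in>V. \<forall>i<m. \<forall>j<m.
            (\<lambda>N. (\<Sum>n=1..N. ((\<phi>^^n) X $$ (i,j)) / complex_of_real (beta_norm m \<beta> (\<phi>^^n))) / of_nat N)
              \<longlonglongrightarrow> \<psi> X $$ (i,j))))"

definition linear_on :: "nat \<Rightarrow> complex mat set \<Rightarrow> (complex mat \<Rightarrow> complex mat) \<Rightarrow> bool" where
  "linear_on m V \<phi> \<longleftrightarrow> (\<forall>X\<in>V. \<phi> X \<in> V) \<and>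
     (\<forall>X\<in>V. \<forall>Y\<in>V. \<forall>a b. \<phi> (a \<cdot>\<^sub>m X + b \<cdot>\<^sub>m Y) = a \<cdot>\<^sub>m \<phi> X + b \<cdot>\<^sub>m \<phi> Y)"

definition map_spectral_radius :: "complex mat set \<Rightarrow> (complex mat \<Rightarrow> complex mat) \<Rightarrow> real" where
  "map_spectral_radius V \<phi> = Sup {cmod c | c. \<exists>X\<in>V. X \<noteq> 0\<^sub>m (dim_row X) (dim_col X) \<and> \<phi> X = c \<cdot>\<^sub>m X}"

definition block_idx :: "nat list \<Rightarrow> nat \<Rightarrow> nat" where
  "block_idx ns i = (LEAST k. i < sum_list (take (Suc k) ns))"

definition block_alg :: "nat list \<Rightarrow> complex mat set" where
  "block_alg ns = {X \<in> carrier_mat (sum_list ns) (sum_list ns).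
      \<forall>i<sum_list ns. \<forall>j<sum_list ns. block_idx ns i \<noteq> block_idx ns j \<longrightarrow> X $$ (i,j) = 0}"

definition bd_part :: "nat list \<Rightarrow> complex mat \<Rightarrow> complex mat" where
  "bd_part ns X = mat (sum_list ns) (sum_list ns)
      (\<lambda>(i,j). if block_idx ns i = block_idx ns j then X $$ (i,j) else 0)"

text \<open>canonical extension iota o sigma o phi (iota is the inclusion)\<close>
definition can_ext :: "nat list \<Rightarrow> (complex mat \<Rightarrow> complex mat) \<Rightarrow> (complex mat \<Rightarrow> complex mat)" where
  "can_ext ns \<sigma> = (\<lambda>X. \<sigma> (bd_part ns X))"

definition psd :: "nat \<Rightarrow> complex mat \<Rightarrow> bool" where
  "psd n Y \<longleftrightarrow> Y \<in> carrier_mat n n \<and>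
     (\<forall>v\<in>carrier_vec n. (Y *\<^sub>v v) \<bullet> conjugate v \<in> \<real> \<and> 0 \<le> Re ((Y *\<^sub>v v) \<bullet> conjugate v))"

definition blk :: "nat \<Rightarrow> complex mat \<Rightarrow> nat \<Rightarrow> nat \<Rightarrow> complex mat" where
  "blk m Y a b = mat m m (\<lambda>(i,j). Y $$ (a*m + i, b*m + j))"

definition amplify :: "nat \<Rightarrow> nat \<Rightarrow> (complex mat \<Rightarrow> complex mat) \<Rightarrow> complex mat \<Rightarrow> complex mat" where
  "amplify m k \<sigma> Y = mat (k*m) (k*m) (\<lambda>(i,j). \<sigma> (blk m Y (i div m) (j div m)) $$ (i mod m, j mod m))"

definition completely_positive_on :: "nat \<Rightarrow> complex mat set \<Rightarrow> (complex mat \<Rightarrow> complex mat) \<Rightarrow> bool" where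
  "completely_positive_on m V \<sigma> \<longleftrightarrow> linear_on m V \<sigma> \<and>
     (\<forall>k>0. \<forall>Y. Y \<in> carrier_mat (k*m) (k*m) \<and> (\<forall>a<k. \<forall>b<k. blk m Y a b \<in> V) \<and> psd (k*m) Y
              \<longrightarrow> psd (k*m) (amplify m k \<sigma> Y))"

definition kraus_sum :: "nat \<Rightarrow> complex mat list \<Rightarrow> complex mat \<Rightarrow> complex mat" where
  "kraus_sum m As X = foldr (\<lambda>A acc. mat_adjoint A * X * A + acc) As (0\<^sub>m m m)"

definition is_kraus :: "nat \<Rightarrow> (complex mat \<Rightarrow> complex mat) \<Rightarrow> complex mat list \<Rightarrow> bool" where
  "is_kraus m \<sigma> As \<longleftrightarrow> set As \<subseteq> carrier_mat m m \<and> (\<forall>X\<in>carrier_mat m m. \<sigma> X = kraus_sum m As X)"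

text \<open>(not necessarily unital) subalgebra of \<open>M_m\<close>\<close>
definition subalg :: "nat \<Rightarrow> complex mat set \<Rightarrow> bool" where
  "subalg m S \<longleftrightarrow> S \<subseteq> carrier_mat m m \<and> 0\<^sub>m m m \<in> S \<and>
     (\<forall>X\<in>S. \<forall>Y\<in>S. X + Y \<in> S \<and> X * Y \<in> S) \<and> (\<forall>c. \<forall>X\<in>S. c \<cdot>\<^sub>m X \<in> S)"

definition gen_alg :: "nat \<Rightarrow> complex mat list \<Rightarrow> complex mat set" where
  "gen_alg m As = \<Inter> {S. subalg m S \<and> set As \<subseteq> S}"

definition is_ideal :: "nat \<Rightarrow> complex mat set \<Rightarrow> complex mat set \<Rightarrow> bool" where
  "is_ideal m I S \<longleftrightarrow> I \<subseteq> S \<and> 0\<^sub>m m m \<in> I \<and>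
     (\<forall>X\<in>I. \<forall>Y\<in>I. X + Y \<in> I) \<and> (\<forall>c. \<forall>X\<in>I. c \<cdot>\<^sub>m X \<in> I) \<and>
     (\<forall>A\<in>S. \<forall>B\<in>I. A * B \<in> I \<and> B * A \<in> I)"

end

theory Submission
  imports Defs "Jordan_Normal_Form.Jordan_Normal_Form_Existence"
    "Jordan_Normal_Form.Jordan_Normal_Form_Uniqueness" "Jordan_Normal_Form.Spectral_Radius"
    "HOL-Real_Asymp.Real_Asymp"
begin

text \<open>
  In Jordan coordinates the entries of \<open>\<phi>\<^sup>n\<close> are \<open>(n choose k) * a ^ (n - k)\<close>, and
  \<open>\<parallel>\<phi>\<^sup>n\<parallel>\<close> is eventually the largest of their moduli, with \<open>\<bar>a\<bar>\<close> maximal and then \<open>k\<close> maximal.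
  After normalisation every entry tends to 0 or is eventually a unimodular geometric sequence,
  so the Cesaro means converge; the norm does not depend on the Jordan basis because the set of
  Jordan blocks is unique. Passing to the canonical extension adds only zero blocks of size 1, which
  do not affect the norm of the powers, whence the first claim.

  For a map \<open>F\<close> with Kraus operators \<open>A\<^sub>i\<close>, the quadratic form of the Choi matrix at \<open>v\<close> is the sum
  of the \<open>\<bar>\<langle>A\<^sub>i, v\<rangle>\<bar>\<^sup>2\<close>; it vanishes exactly when \<open>v\<close> is orthogonal to all \<open>A\<^sub>i\<close>, so it determines
  \<open>span {A\<^sub>i}\<close>. Let \<open>T\<close> be the extended map and \<open>\<psi>\<close> its maximal part. The Kraus operators of \<open>T\<^sup>n\<close>
  are words in those of \<open>T\<close>, so in the limit those of \<open>\<psi>\<close> lie in the generated algebra. Since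
  \<open>\<parallel>T\<^sup>n\<^sup>+\<^sup>1\<parallel> \<le> K \<parallel>T\<^sup>n\<parallel>\<close>, the forms of \<open>T \<circ> \<psi> = \<psi> \<circ> T\<close> are at most \<open>K\<close> times the form of \<open>\<psi>\<close>, so the
  products \<open>B\<^sub>j A\<^sub>i\<close> and \<open>A\<^sub>i B\<^sub>j\<close> stay in \<open>span {B\<^sub>j}\<close>. Finally \<open>\<psi> \<noteq> 0\<close> because
  \<open>\<parallel>T\<^sup>n\<parallel>\<close> is bounded by a multiple of the trace of the Choi matrix of \<open>T\<^sup>n\<close>, which depends linearly on the map.
\<close>

section \<open>Cesaro limits\<close>

lemma tendsto_zero_norm_comparison:
  fixes f :: "'a \<Rightarrow> 'b :: real_normed_vector" and g :: "'a \<Rightarrow> real"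
  assumes "eventually (\<lambda>x. norm (f x) \<le> g x) F" "(g \<longlongrightarrow> 0) F"
  shows "(f \<longlongrightarrow> 0) F"
  using assms(2) by (rule tendsto_0_le[of _ _ _ 1]) (use assms(1) in eventually_elim, simp)

definition cesaro_tendsto :: "(nat \<Rightarrow> 'a :: real_normed_field) \<Rightarrow> 'a \<Rightarrow> bool" where
  "cesaro_tendsto u l \<longleftrightarrow> (\<lambda>N. (\<Sum>n=1..N. u n) / of_nat N) \<longlonglongrightarrow> l"

lemma cesaro_tendsto_unique: "cesaro_tendsto u l \<Longrightarrow> cesaro_tendsto u l' \<Longrightarrow> l = l'"
  unfolding cesaro_tendsto_def by (rule LIMSEQ_unique)

lemma cesaro_tendsto_const: "cesaro_tendsto (\<lambda>n. c) c"
  unfolding cesaro_tendsto_def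
  by (rule tendsto_eventually) (auto simp: eventually_sequentially intro!: exI[of _ 1])

lemma cesaro_tendsto_add:
  "cesaro_tendsto u l \<Longrightarrow> cesaro_tendsto v k \<Longrightarrow> cesaro_tendsto (\<lambda>n. u n + v n) (l + k)"
  unfolding cesaro_tendsto_def by (drule (1) tendsto_add) (simp add: sum.distrib add_divide_distrib)

lemma cesaro_tendsto_mult_left:
  "cesaro_tendsto u l \<Longrightarrow> cesaro_tendsto (\<lambda>n. c * u n) (c * l)"
  unfolding cesaro_tendsto_def by (drule tendsto_mult_left[of _ _ _ c]) (simp add: sum_distrib_left)

lemma cesaro_tendsto_sum:
  assumes "\<And>x. x \<in> S \<Longrightarrow> cesaro_tendsto (u x) (l x)"
  shows "cesaro_tendsto (\<lambda>n. \<Sum>x\<in>S. u x n) (\<Sum>x\<in>S. l x)"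
  using assms by (induction S rule: infinite_finite_induct)
    (auto intro: cesaro_tendsto_add cesaro_tendsto_const)

lemma cesaro_tendsto_Re: "cesaro_tendsto u l \<Longrightarrow> cesaro_tendsto (\<lambda>n. Re (u n)) (Re l)"
  unfolding cesaro_tendsto_def
  by (drule tendsto_Re) simp

lemma cesaro_tendsto_le:
  fixes u v :: "nat \<Rightarrow> real"
  assumes "cesaro_tendsto u l" "cesaro_tendsto v k" "\<And>n. n \<ge> 1 \<Longrightarrow> u n \<le> v n"
  shows "l \<le> k"
proof (rule LIMSEQ_le[OF assms(1,2)[unfolded cesaro_tendsto_def]])
  show "\<exists>N0. \<forall>N\<ge>N0. (\<Sum>n=1..N. u n) / of_nat N \<le> (\<Sum>n=1..N. v n) / of_nat N"
    using assms(3) by (intro exI allI impI divide_right_mono sum_mono) auto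
qed

lemma cesaro_tendsto_Suc:
  assumes "cesaro_tendsto u l"
  shows "cesaro_tendsto (\<lambda>n. u (Suc n)) l"
proof -
  define M where "M = (\<lambda>N. (\<Sum>n=1..N. u n) / of_nat N)"
  have "(\<lambda>N. of_real ((real N + 1) / real N) * M (Suc N) - u 1 / of_nat N) \<longlonglongrightarrow> of_real 1 * l - 0"
  proof (intro tendsto_diff tendsto_mult tendsto_of_real)
    show "(\<lambda>N. (real N + 1) / real N) \<longlonglongrightarrow> 1" by real_asymp
    show "(\<lambda>N. M (Suc N)) \<longlonglongrightarrow> l"
      using assms unfolding cesaro_tendsto_def M_def by (rule LIMSEQ_Suc)
    show "(\<lambda>N. u 1 / of_nat N) \<longlonglongrightarrow> 0" by (rule lim_const_over_n)
  qed
  moreover have "of_real ((real N + 1) / real N) * M (Suc N) - u 1 / of_nat N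
      = (\<Sum>n=1..N. u (Suc n)) / of_nat N" if "N \<ge> 1" for N
  proof -
    have "(\<Sum>n=1..Suc N. u n) = u 1 + (\<Sum>n=1..N. u (Suc n))"
      by (subst sum.atLeast_Suc_atMost)
        (simp_all add: sum.atLeast_Suc_atMost_Suc_shift del: sum.cl_ivl_Suc)
    moreover have "of_real ((real N + 1) / real N) = (of_nat (Suc N) / of_nat N :: 'a)"
      by (simp add: add.commute)
    hence "of_real ((real N + 1) / real N) * M (Suc N)
        = of_nat (Suc N) / of_nat N * ((\<Sum>n=1..Suc N. u n) / of_nat (Suc N))"
      by (simp only: M_def)
    hence "of_real ((real N + 1) / real N) * M (Suc N) = (\<Sum>n=1..Suc N. u n) / of_nat N"
      by (simp del: of_nat_Suc sum.cl_ivl_Suc)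
    ultimately show ?thesis by (simp add: add_divide_distrib)
  qed
  ultimately show ?thesis unfolding cesaro_tendsto_def
    by (simp add: Lim_transform_eventually eventually_sequentiallyI[of 1])
qed

lemma tendsto_0_imp_cesaro_tendsto_0:
  fixes u :: "nat \<Rightarrow> 'a :: real_normed_field"
  assumes "u \<longlonglongrightarrow> 0"
  shows "cesaro_tendsto u 0"
  unfolding cesaro_tendsto_def
proof (rule LIMSEQ_I)
  fix e :: real assume e_pos: "0 < e"
  then obtain n0 where tail: "\<And>n. n \<ge> n0 \<Longrightarrow> norm (u n) < e/2"
    using LIMSEQ_D[OF assms, of "e/2"] by auto
  define C where "C = (\<Sum>n=1..n0. norm (u n))"
  obtain n1 :: nat where n1: "2 * C / e < real n1" using reals_Archimedean2 by blast
  show "\<exists>N0. \<forall>N\<ge>N0. norm ((\<Sum>n=1..N. u n) / of_nat N - 0) < e"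
  proof (intro exI allI impI)
    fix N assume N: "N \<ge> Suc (max n0 n1)"
    have "norm (\<Sum>n=1..N. u n) \<le> (\<Sum>n=1..N. norm (u n))" by (rule norm_sum)
    also have "\<dots> \<le> (\<Sum>n=1..N. (if n \<le> n0 then norm (u n) else 0) + e/2)"
      by (rule sum_mono) (use tail e_pos in \<open>auto simp: less_imp_le\<close>)
    also have "\<dots> = (\<Sum>n=1..N. (if n \<le> n0 then norm (u n) else 0)) + N * (e/2)"
      by (simp add: sum.distrib)
    also have "(\<Sum>n=1..N. (if n \<le> n0 then norm (u n) else 0)) = C"
      unfolding C_def by (rule sum.mono_neutral_cong_right) (use N in auto)
    also have "C + N * (e/2) < N * e"
    proof -
      have "2 * C / e < real N" using n1 N by linarith
      thus ?thesis using e_pos by (simp add: field_simps)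
    qed
    finally show "norm ((\<Sum>n=1..N. u n) / of_nat N - 0) < e"
      using N by (simp add: norm_divide field_simps)
  qed
qed

lemma cesaro_tendsto_eventually_cong:
  assumes "cesaro_tendsto u l" "eventually (\<lambda>n. v n = u n) sequentially"
  shows "cesaro_tendsto v l"
proof -
  have "(\<lambda>n. v n - u n) \<longlonglongrightarrow> 0"
    by (rule tendsto_eventually) (use assms(2) in eventually_elim, simp)
  from cesaro_tendsto_add[OF assms(1) tendsto_0_imp_cesaro_tendsto_0[OF this]] show ?thesis by simp
qed

lemma cesaro_tendsto_power:
  fixes w :: "'a :: real_normed_field"
  assumes "norm w = 1"
  shows "cesaro_tendsto (\<lambda>n. w ^ n) (if w = 1 then 1 else 0)"
proof (cases "w = 1")
  case True thus ?thesis using cesaro_tendsto_const[of 1] by simp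
next
  case False
  have "norm ((\<Sum>n=1..N. w ^ n) / of_nat N) \<le> 2 / norm (1 - w) / real N" for N
  proof -
    have "norm (\<Sum>n=1..N. w ^ n) \<le> norm (w - w ^ Suc N) / norm (1 - w)"
      using False by (simp add: sum_gp norm_divide)
    also have "norm (w - w ^ Suc N) \<le> norm w + norm (w ^ Suc N)" by (rule norm_triangle_ineq4)
    also have "\<dots> = 2" using assms by (simp add: norm_power norm_mult)
    finally have "norm (\<Sum>n=1..N. w ^ n) \<le> 2 / norm (1 - w)" by (simp add: divide_right_mono)
    thus ?thesis unfolding norm_divide norm_of_nat by (rule divide_right_mono) simp
  qed
  hence "(\<lambda>N. (\<Sum>n=1..N. w ^ n) / of_nat N) \<longlonglongrightarrow> 0"
    by (intro tendsto_zero_norm_comparison[OF _ lim_const_over_n[of "2 / norm (1 - w)"]] always_eventually) simp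
  thus ?thesis using False by (simp add: cesaro_tendsto_def)
qed

section \<open>Growth of Jordan entries\<close>

text \<open>The entry on the \<open>k\<close>-th superdiagonal of the \<open>n\<close>-th power of a Jordan block with eigenvalue \<open>a\<close>.\<close>

definition jordan_entry :: "nat \<Rightarrow> complex \<Rightarrow> nat \<Rightarrow> complex" where
  "jordan_entry k a n = of_nat (n choose k) * a ^ (n - k)"

definition growth_le :: "nat \<times> complex \<Rightarrow> nat \<times> complex \<Rightarrow> bool" where
  "growth_le x y \<longleftrightarrow> cmod (snd x) < cmod (snd y) \<or> cmod (snd x) = cmod (snd y) \<and> fst x \<le> fst y"

definition jordan_growth :: "(nat \<times> complex) set \<Rightarrow> nat \<Rightarrow> real" where
  "jordan_growth E n = Max (insert 0 ((\<lambda>(k,a). cmod (jordan_entry k a n)) ` E))"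

lemma norm_jordan_entry: "cmod (jordan_entry k a n) = real (n choose k) * cmod a ^ (n - k)"
  by (simp add: jordan_entry_def norm_mult norm_power)

lemma jordan_growth_ge: "finite E \<Longrightarrow> (k,a) \<in> E \<Longrightarrow> cmod (jordan_entry k a n) \<le> jordan_growth E n"
  unfolding jordan_growth_def by (intro Max_ge) (auto intro!: image_eqI[of _ _ "(k,a)"])

lemma jordan_growth_nonneg: "finite E \<Longrightarrow> 0 \<le> jordan_growth E n"
  unfolding jordan_growth_def by (intro Max_ge) auto

lemma jordan_growth_le:
  assumes "finite E" "0 \<le> x" "\<And>k a. (k,a) \<in> E \<Longrightarrow> cmod (jordan_entry k a n) \<le> x"
  shows "jordan_growth E n \<le> x"
  unfolding jordan_growth_def using assms by (subst Max_le_iff) auto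

lemma finite_has_growth_greatest:
  assumes "finite E" "E \<noteq> {}"
  shows "\<exists>y\<in>E. \<forall>x\<in>E. growth_le x y"
  using assms
proof (induction E rule: finite_ne_induct)
  case (insert z E)
  then obtain y where y: "y \<in> E" "\<forall>x\<in>E. growth_le x y" by blast
  show ?case
  proof (cases "growth_le z y")
    case False
    hence "growth_le x z" if "growth_le x y" for x using that by (auto simp: growth_le_def)
    hence "\<forall>x\<in>insert z E. growth_le x z" using y(2) by (auto simp: growth_le_def)
    thus ?thesis by blast
  qed (use y in blast)
qed (simp add: growth_le_def)

lemma binomial_ratio_tendsto_0:
  assumes "k < l"
  shows "(\<lambda>n. real (n choose k) / real (n choose l)) \<longlonglongrightarrow> 0"
proof (rule tendsto_zero_norm_comparison)
  show "(\<lambda>n. real l ^ l / real n) \<longlonglongrightarrow> 0" by (rule lim_const_over_n)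
  have "real (n choose k) / real (n choose l) \<le> real l ^ l / real n" if n: "n \<ge> l" for n
  proof -
    have pos: "n > 0" "l > 0" using assms n by auto
    have "n choose k \<le> n ^ k" using assms n by (intro binomial_le_pow) simp
    hence "real (n choose k) \<le> real n ^ k" by (simp flip: of_nat_power)
    moreover have "(real n / real l) ^ l \<le> real (n choose l)"
      using binomial_ge_n_over_k_pow_k[OF n, where 'a=real] by simp
    ultimately have "real (n choose k) / real (n choose l) \<le> real n ^ k / (real n / real l) ^ l"
      using pos by (intro frac_le) auto
    also have "\<dots> = real l ^ l * (real n ^ k / real n ^ l)" by (simp add: power_divide)
    also have "real n ^ k / real n ^ l \<le> 1 / real n"
      using power_increasing[of "Suc k" l "real n"] assms pos by (simp add: field_simps)
    finally show ?thesis by (simp add: mult_left_mono)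
  qed
  thus "\<forall>\<^sub>F n in sequentially. norm (real (n choose k) / real (n choose l)) \<le> real l ^ l / real n"
    by (auto intro: eventually_sequentiallyI[of l])
qed

lemma binomial_ratio_times_geometric_tendsto_0:
  fixes q :: real
  assumes "0 < q" "q < 1"
  shows "(\<lambda>n. real (n choose k) / real (n choose l) * q ^ n) \<longlonglongrightarrow> 0"
proof (rule tendsto_zero_norm_comparison)
  show "(\<lambda>n. real n ^ k * q ^ n) \<longlonglongrightarrow> 0" using assms by real_asymp
  have "real (n choose k) / real (n choose l) * q ^ n \<le> real n ^ k * q ^ n" if n: "n \<ge> max k l" for n
  proof -
    have "n choose k \<le> n ^ k" using n by (intro binomial_le_pow) simp
    hence "real (n choose k) \<le> real n ^ k" by (simp flip: of_nat_power)
    moreover have "1 \<le> real (n choose l)" using n by (simp add: Suc_leI)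
    ultimately have "real (n choose k) / real (n choose l) \<le> real n ^ k / 1" by (intro frac_le) auto
    thus ?thesis using assms by (intro mult_right_mono) auto
  qed
  thus "\<forall>\<^sub>F n in sequentially.
      norm (real (n choose k) / real (n choose l) * q ^ n) \<le> real n ^ k * q ^ n"
    using assms by (auto intro: eventually_sequentiallyI[of "max k l"])
qed

lemma jordan_entry_ratio_tendsto_0:
  assumes "b \<noteq> 0" and less: "\<not> growth_le (l,b) (k,a)"
  shows "(\<lambda>n. cmod (jordan_entry k a n) / cmod (jordan_entry l b n)) \<longlonglongrightarrow> 0"
proof (cases "a = 0")
  case True
  thus ?thesis
    by (intro tendsto_eventually eventually_sequentiallyI[of "Suc k"]) (simp add: norm_jordan_entry)
next
  case False
  define q where "q = cmod a / cmod b"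
  have "(\<lambda>n. real (n choose k) / real (n choose l) * q ^ n) \<longlonglongrightarrow> 0"
  proof (cases "cmod a < cmod b")
    case True
    thus ?thesis using False assms(1)
      by (intro binomial_ratio_times_geometric_tendsto_0) (auto simp: q_def)
  next
    case equal_modulus: False
    hence "cmod a = cmod b" "k < l" using less by (auto simp: growth_le_def)
    thus ?thesis using binomial_ratio_tendsto_0 assms(1) by (simp add: q_def)
  qed
  hence "(\<lambda>n. cmod b ^ l / cmod a ^ k * (real (n choose k) / real (n choose l) * q ^ n)) \<longlonglongrightarrow> 0"
    by (rule tendsto_mult_right_zero)
  thus ?thesis
  proof (rule Lim_transform_eventually)
    show "\<forall>\<^sub>F n in sequentially. cmod b ^ l / cmod a ^ k * (real (n choose k) / real (n choose l) * q ^ n)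
        = cmod (jordan_entry k a n) / cmod (jordan_entry l b n)"
      using eventually_ge_at_top[of "max k l"]
    proof eventually_elim
      case (elim n)
      thus ?case using False assms(1) by (simp add: norm_jordan_entry q_def power_diff power_divide)
    qed
  qed
qed

lemma eventually_jordan_growth_eq:
  assumes fin: "finite E" and lb: "(l,b) \<in> E" "b \<noteq> 0" and greatest: "\<forall>x\<in>E. growth_le x (l,b)"
  shows "eventually (\<lambda>n. jordan_growth E n = cmod (jordan_entry l b n)) sequentially"
proof -
  have "eventually (\<lambda>n. cmod (jordan_entry k a n) \<le> cmod (jordan_entry l b n)) sequentially"
    if "(k,a) \<in> E" for k a
  proof (cases "growth_le (l,b) (k,a)")
    case True
    with greatest[THEN bspec, OF that] have "k = l" "cmod a = cmod b" by (auto simp: growth_le_def)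
    thus ?thesis by (simp add: norm_jordan_entry)
  next
    case False
    from order_tendstoD(2)[OF jordan_entry_ratio_tendsto_0[OF lb(2) this], of 1]
    have "eventually (\<lambda>n. cmod (jordan_entry k a n) / cmod (jordan_entry l b n) < 1) sequentially" by simp
    thus ?thesis using eventually_ge_at_top[of l]
    proof eventually_elim
      case (elim n)
      moreover have "cmod (jordan_entry l b n) > 0" using elim lb(2) by (simp add: norm_jordan_entry)
      ultimately show ?case by (simp add: field_simps)
    qed
  qed
  hence "eventually (\<lambda>n. \<forall>x\<in>E. cmod (jordan_entry (fst x) (snd x) n) \<le> cmod (jordan_entry l b n)) sequentially"
    using fin by (intro eventually_ball_finite) auto
  thus ?thesis
  proof eventually_elim
    case (elim n)
    show ?case
    proof (rule antisym)
      show "jordan_growth E n \<le> cmod (jordan_entry l b n)"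
        using elim by (intro jordan_growth_le[OF fin]) auto
    qed (rule jordan_growth_ge[OF fin lb(1)])
  qed
qed

lemma jordan_entry_normalised_by_equal_modulus:
  assumes modulus: "cmod a = cmod b" "b \<noteq> 0" and "n \<ge> l"
  defines "w \<equiv> a / complex_of_real (cmod b)"
  shows "jordan_entry l a n / complex_of_real (cmod (jordan_entry l b n)) = 1 / w ^ l * w ^ n"
proof -
  have "a = w * of_real (cmod b)" using modulus(2) by (simp add: w_def)
  moreover have norm_w: "cmod w = 1" using modulus by (simp add: w_def norm_divide)
  ultimately have "jordan_entry l a n = w ^ (n - l) * of_real (cmod (jordan_entry l b n))"
    by (simp add: jordan_entry_def power_mult_distrib norm_mult norm_power)
  hence "jordan_entry l a n / of_real (cmod (jordan_entry l b n)) = w ^ (n - l)"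
    using modulus(2) \<open>n \<ge> l\<close> by (simp add: norm_jordan_entry)
  moreover have "w \<noteq> 0" using norm_w by auto
  ultimately show ?thesis using \<open>n \<ge> l\<close> by (simp add: power_diff)
qed

lemma normalised_jordan_entry_cesaro_convergent:
  assumes finite: "finite E" and nonzero: "(k0,a0) \<in> E" "a0 \<noteq> 0" and entry: "(k,a) \<in> E"
  shows "\<exists>L. cesaro_tendsto (\<lambda>n. jordan_entry k a n / of_real (jordan_growth E n)) L"
proof -
  obtain l b where dominant: "(l,b) \<in> E" "\<forall>x\<in>E. growth_le x (l,b)"
    using finite_has_growth_greatest[OF finite] nonzero(1) by fastforce
  have b: "b \<noteq> 0" using dominant(2)[THEN bspec, OF nonzero(1)] nonzero(2) by (auto simp: growth_le_def)
  note growth = eventually_jordan_growth_eq[OF finite dominant(1) b dominant(2)]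
  show ?thesis
  proof (cases "growth_le (l,b) (k,a)")
    case False
    have "(\<lambda>n. jordan_entry k a n / of_real (jordan_growth E n)) \<longlonglongrightarrow> 0"
    proof (rule tendsto_norm_zero_cancel, rule Lim_transform_eventually)
      show "(\<lambda>n. cmod (jordan_entry k a n) / cmod (jordan_entry l b n)) \<longlonglongrightarrow> 0"
        by (rule jordan_entry_ratio_tendsto_0[OF b False])
      show "eventually (\<lambda>n. cmod (jordan_entry k a n) / cmod (jordan_entry l b n)
          = cmod (jordan_entry k a n / of_real (jordan_growth E n))) sequentially"
        using growth by eventually_elim (simp add: norm_divide)
    qed
    from tendsto_0_imp_cesaro_tendsto_0[OF this] show ?thesis by blast
  next
    case True
    with dominant(2)[THEN bspec, OF entry] have "k = l" and modulus: "cmod a = cmod b"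
      by (auto simp: growth_le_def)
    define w where "w = a / of_real (cmod b)"
    have norm_w: "cmod w = 1" using modulus b by (simp add: w_def norm_divide)
    have "eventually (\<lambda>n. jordan_entry k a n / of_real (jordan_growth E n) = 1 / w ^ l * w ^ n) sequentially"
      using growth eventually_ge_at_top[of l]
      by eventually_elim
        (simp only: \<open>k = l\<close> w_def jordan_entry_normalised_by_equal_modulus[OF modulus b])
    from cesaro_tendsto_eventually_cong[OF cesaro_tendsto_mult_left[OF cesaro_tendsto_power[OF norm_w]] this]
    show ?thesis by blast
  qed
qed

section \<open>Powers of Jordan matrices\<close>

definition jordan_indices :: "(nat \<times> complex) list \<Rightarrow> (nat \<times> complex) set" where
  "jordan_indices n_as = {(k,a). \<exists>s. (s,a) \<in> set n_as \<and> k < s}"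

lemma finite_jordan_indices: "finite (jordan_indices n_as)"
proof -
  have "jordan_indices n_as \<subseteq> (\<Union>(s,a)\<in>set n_as. (\<lambda>k. (k,a)) ` {..<s})"
    by (auto simp: jordan_indices_def)
  thus ?thesis by (rule finite_subset) auto
qed

lemma jordan_indices_append: "jordan_indices (xs @ ys) = jordan_indices xs \<union> jordan_indices ys"
  by (auto simp: jordan_indices_def)

lemma jordan_indices_Cons:
  "jordan_indices ((s,a) # n_as) = (\<lambda>k. (k,a)) ` {..<s} \<union> jordan_indices n_as"
  by (auto simp: jordan_indices_def)

lemma jordan_indices_nonempty_iff: "jordan_indices n_as \<noteq> {} \<longleftrightarrow> sum_list (map fst n_as) > 0"
proof (induction n_as)
  case (Cons sa n_as)
  thus ?case by (cases sa) (simp add: jordan_indices_Cons lessThan_empty_iff)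
qed (simp add: jordan_indices_def)

lemma jordan_growth_Un_zero_entries:
  assumes "finite E" "finite F" "\<And>k a. (k,a) \<in> F \<Longrightarrow> jordan_entry k a n = 0"
  shows "jordan_growth (F \<union> E) n = jordan_growth E n"
proof (rule antisym)
  show "jordan_growth (F \<union> E) n \<le> jordan_growth E n"
    using assms by (intro jordan_growth_le) (auto intro: jordan_growth_nonneg jordan_growth_ge)
  show "jordan_growth E n \<le> jordan_growth (F \<union> E) n"
    using assms by (intro jordan_growth_le) (auto intro: jordan_growth_nonneg jordan_growth_ge)
qed

lemma jordan_growth_indices_pos:
  assumes "(k,a) \<in> jordan_indices n_as" "a \<noteq> 0"
  shows "jordan_growth (jordan_indices n_as) n > 0"
proof -
  have "(0,a) \<in> jordan_indices n_as" using assms(1) by (auto simp: jordan_indices_def)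
  from jordan_growth_ge[OF finite_jordan_indices this]
  have "cmod a ^ n \<le> jordan_growth (jordan_indices n_as) n" by (simp add: norm_jordan_entry)
  moreover have "cmod a ^ n > 0" using assms(2) by simp
  ultimately show ?thesis by linarith
qed

lemma jordan_matrix_pow_carrier:
  "jordan_matrix n_as ^\<^sub>m n \<in> carrier_mat (sum_list (map fst n_as)) (sum_list (map fst n_as))"
  by (rule pow_carrier_mat[OF jordan_matrix_carrier])

lemma jordan_block_pow_index:
  assumes "i < s" "j < s"
  shows "(jordan_block s a ^\<^sub>m n) $$ (i,j) = (if i \<le> j then jordan_entry (j - i) a n else 0)"
  using assms unfolding jordan_block_pow jordan_entry_def by auto

lemma jordan_matrix_Cons_pow_index:
  fixes n_as :: "(nat \<times> complex) list"
  defines "d \<equiv> sum_list (map fst n_as)"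
  assumes "i < s + d" "j < s + d"
  shows "(jordan_matrix ((s,a) # n_as) ^\<^sub>m n) $$ (i,j) =
    (if i < s \<and> j < s then if i \<le> j then jordan_entry (j - i) a n else 0
     else if i < s \<or> j < s then 0 else (jordan_matrix n_as ^\<^sub>m n) $$ (i - s, j - s))"
proof -
  have "jordan_matrix ((s,a) # n_as) ^\<^sub>m n
      = four_block_mat (jordan_block s a ^\<^sub>m n) (0\<^sub>m s d) (0\<^sub>m d s) (jordan_matrix n_as ^\<^sub>m n)"
    unfolding jordan_matrix_Cons d_def by (rule pow_four_block_mat) auto
  thus ?thesis using assms jordan_matrix_pow_carrier[of n_as n]
    by (auto simp: jordan_block_pow_index)
qed

lemma jordan_matrix_pow_index_cases:
  assumes "i < sum_list (map fst n_as)" "j < sum_list (map fst n_as)"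
  shows "(\<forall>n. (jordan_matrix n_as ^\<^sub>m n) $$ (i,j) = 0)
    \<or> (\<exists>(k,a)\<in>jordan_indices n_as. \<forall>n. (jordan_matrix n_as ^\<^sub>m n) $$ (i,j) = jordan_entry k a n)"
  using assms
proof (induction n_as arbitrary: i j)
  case (Cons sa n_as)
  obtain s a where sa: "sa = (s,a)" by (cases sa)
  have ij: "i < s + sum_list (map fst n_as)" "j < s + sum_list (map fst n_as)"
    using Cons.prems by (auto simp: sa)
  consider "i < s" "j < s" | "\<not> i < s" "\<not> j < s" | "i < s \<longleftrightarrow> \<not> j < s" by blast
  thus ?case
  proof cases
    case 1
    thus ?thesis unfolding sa jordan_matrix_Cons_pow_index[OF ij] jordan_indices_Cons
      by (auto intro!: bexI[of _ "(j - i, a)"])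
  next
    case 2
    thus ?thesis using Cons.IH[of "i - s" "j - s"] ij
      unfolding sa jordan_matrix_Cons_pow_index[OF ij] jordan_indices_Cons by auto
  next
    case 3
    thus ?thesis unfolding sa jordan_matrix_Cons_pow_index[OF ij] by auto
  qed
qed simp

lemma jordan_entry_occurs:
  assumes "(k,a) \<in> jordan_indices n_as"
  shows "\<exists>i<sum_list (map fst n_as). \<exists>j<sum_list (map fst n_as).
    \<forall>n. (jordan_matrix n_as ^\<^sub>m n) $$ (i,j) = jordan_entry k a n"
  using assms
proof (induction n_as)
  case (Cons sb n_as)
  obtain s b where sb: "sb = (s,b)" by (cases sb)
  note index = jordan_matrix_Cons_pow_index[of _ s n_as]
  from Cons.prems consider "k < s" "a = b" | "(k,a) \<in> jordan_indices n_as"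
    unfolding sb jordan_indices_Cons by auto
  thus ?case
  proof cases
    case 1
    thus ?thesis unfolding sb by (intro exI[of _ 0] conjI exI[of _ k]) (auto simp: index)
  next
    case 2
    then obtain i j where "i < sum_list (map fst n_as)" "j < sum_list (map fst n_as)"
      "\<And>n. (jordan_matrix n_as ^\<^sub>m n) $$ (i,j) = jordan_entry k a n" using Cons.IH by blast
    thus ?thesis unfolding sb
      by (intro exI[of _ "s + i"] conjI exI[of _ "s + j"]) (auto simp: index)
  qed
qed (simp add: jordan_indices_def)

lemma norm_bound_jordan_matrix_pow_iff:
  assumes "sum_list (map fst n_as) > 0"
  shows "norm_bound (jordan_matrix n_as ^\<^sub>m n) c \<longleftrightarrow> jordan_growth (jordan_indices n_as) n \<le> c"
    (is "norm_bound ?J c \<longleftrightarrow> ?g \<le> c")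
proof
  let ?d = "sum_list (map fst n_as)"
  have dim: "dim_row ?J = ?d" "dim_col ?J = ?d" using jordan_matrix_pow_carrier[of n_as n] by auto
  show "?g \<le> c" if bound: "norm_bound ?J c"
  proof (rule jordan_growth_le[OF finite_jordan_indices])
    have "cmod (?J $$ (0,0)) \<le> c" using bound assms by (simp add: norm_bound_def dim)
    thus "0 \<le> c" using norm_ge_zero order_trans by blast
  next
    fix k a assume "(k,a) \<in> jordan_indices n_as"
    from jordan_entry_occurs[OF this] bound show "cmod (jordan_entry k a n) \<le> c"
      by (metis norm_bound_def dim)
  qed
  show "norm_bound ?J c" if "?g \<le> c"
    unfolding norm_bound_def dim
  proof (intro allI impI)
    fix i j assume "i < ?d" "j < ?d"
    from jordan_matrix_pow_index_cases[OF this] have "cmod (?J $$ (i,j)) \<le> ?g"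
      using jordan_growth_ge[OF finite_jordan_indices] jordan_growth_nonneg[OF finite_jordan_indices]
      by fastforce
    thus "cmod (?J $$ (i,j)) \<le> c" using that by linarith
  qed
qed

lemma jordan_matrix_append:
  fixes xs ys :: "(nat \<times> complex) list"
  defines "q \<equiv> sum_list (map fst xs)" and "d \<equiv> sum_list (map fst ys)"
  shows "jordan_matrix (xs @ ys) = four_block_mat (jordan_matrix xs) (0\<^sub>m q d) (0\<^sub>m d q) (jordan_matrix ys)"
  unfolding q_def d_def jordan_matrix_def map_append diag_block_mat_append Let_def
  by (simp flip: jordan_matrix_def)

lemma jordan_matrix_replicate_zero: "jordan_matrix (replicate q (1,0)) = (0\<^sub>m q q :: complex mat)"
proof (induction q)
  case (Suc q)
  have "sum_list (map fst (replicate q (1 :: nat, 0 :: complex))) = q"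
    by (simp add: sum_list_replicate)
  thus ?case using Suc by (auto simp: jordan_matrix_Cons intro!: eq_matI)
qed (simp add: jordan_matrix_def)

lemma jordan_matrix_filter_nonempty_blocks:
  "jordan_matrix (filter (\<lambda>x. fst x \<noteq> 0) n_as) = (jordan_matrix n_as :: complex mat)"
proof (induction n_as)
  case (Cons sa n_as)
  obtain s a where sa: "sa = (s,a)" by (cases sa)
  have "sum_list (map fst (filter (\<lambda>x. fst x \<noteq> 0) n_as)) = sum_list (map fst n_as)"
    by (induction n_as) auto
  thus ?case using Cons unfolding sa
    by (cases "s = 0") (auto simp: jordan_matrix_Cons intro!: eq_matI)
qed simp

lemma jordan_indices_similar:
  assumes "similar_mat (jordan_matrix xs) (jordan_matrix ys)"
  shows "jordan_indices xs = jordan_indices ys"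
proof -
  let ?nonempty = "filter (\<lambda>x::nat \<times> complex. fst x \<noteq> 0)"
  have "jordan_nf (jordan_matrix xs) (?nonempty xs)" "jordan_nf (jordan_matrix xs) (?nonempty ys)"
    unfolding jordan_nf_def jordan_matrix_filter_nonempty_blocks
    using similar_mat_refl[OF jordan_matrix_carrier] assms by auto
  hence "set (?nonempty xs) = set (?nonempty ys)" by (rule jordan_nf_unique)
  hence "jordan_indices (?nonempty xs) = jordan_indices (?nonempty ys)" by (simp only: jordan_indices_def)
  moreover have "jordan_indices (?nonempty zs) = jordan_indices zs" for zs
    by (auto simp: jordan_indices_def)
  ultimately show ?thesis by (simp only:)
qed

lemma eigenvalue_jordan_matrix_iff:
  fixes n_as :: "(nat \<times> complex) list"
  shows "eigenvalue (jordan_matrix n_as) a \<longleftrightarrow> (0,a) \<in> jordan_indices n_as"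
proof -
  have "poly (\<Prod>(n,b)\<leftarrow>n_as. [:- b, 1:] ^ n) a = 0 \<longleftrightarrow> (0,a) \<in> jordan_indices n_as"
    by (induction n_as) (auto simp: jordan_indices_def)
  thus ?thesis
    unfolding eigenvalue_root_char_poly[OF jordan_matrix_carrier] jordan_matrix_char_poly .
qed

section \<open>Subspaces of matrices and linear maps\<close>

definition mat_subspace :: "nat \<Rightarrow> complex mat set \<Rightarrow> bool" where
  "mat_subspace m V \<longleftrightarrow> V \<subseteq> carrier_mat m m \<and> 0\<^sub>m m m \<in> V \<and>
     (\<forall>X\<in>V. \<forall>Y\<in>V. X + Y \<in> V) \<and> (\<forall>c. \<forall>X\<in>V. c \<cdot>\<^sub>m X \<in> V)"

lemma mat_subspace_carrier: "mat_subspace m V \<Longrightarrow> X \<in> V \<Longrightarrow> X \<in> carrier_mat m m"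
  by (auto simp: mat_subspace_def)

lemma mat_subspace_carrier_mat: "mat_subspace m (carrier_mat m m)"
  by (simp add: mat_subspace_def)

lemma mat_subspace_zero: "mat_subspace m V \<Longrightarrow> 0\<^sub>m m m \<in> V"
  by (simp add: mat_subspace_def)

lemma mat_subspace_add: "mat_subspace m V \<Longrightarrow> X \<in> V \<Longrightarrow> Y \<in> V \<Longrightarrow> X + Y \<in> V"
  by (simp add: mat_subspace_def)

lemma mat_subspace_smult: "mat_subspace m V \<Longrightarrow> X \<in> V \<Longrightarrow> c \<cdot>\<^sub>m X \<in> V"
  by (simp add: mat_subspace_def)

lemma mat_subspace_minus:
  assumes V: "mat_subspace m V" and X: "X \<in> V" and Y: "Y \<in> V"
  shows "X - Y \<in> V"
proof -
  have "X - Y = X + (-1) \<cdot>\<^sub>m Y"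
    using V X Y by (intro eq_matI) (auto dest: mat_subspace_carrier)
  thus ?thesis using V X Y by (simp add: mat_subspace_add mat_subspace_smult)
qed

lemma smult_one_mat: "(1 :: 'a :: comm_ring_1) \<cdot>\<^sub>m X = X"
  by (rule eq_matI) auto

lemma linear_on_add:
  assumes "linear_on m V \<phi>" "X \<in> V" "Y \<in> V"
  shows "\<phi> (X + Y) = \<phi> X + \<phi> Y"
proof -
  have "\<phi> (1 \<cdot>\<^sub>m X + 1 \<cdot>\<^sub>m Y) = 1 \<cdot>\<^sub>m \<phi> X + 1 \<cdot>\<^sub>m \<phi> Y"
    using assms unfolding linear_on_def by blast
  thus ?thesis by (simp add: smult_one_mat)
qed

lemma linear_on_smult:
  assumes V: "mat_subspace m V" and lin: "linear_on m V \<phi>" and X: "X \<in> V"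
  shows "\<phi> (c \<cdot>\<^sub>m X) = c \<cdot>\<^sub>m \<phi> X"
proof -
  have "X \<in> carrier_mat m m" "\<phi> X \<in> carrier_mat m m"
    using V lin X by (auto simp: linear_on_def mat_subspace_carrier)
  hence "c \<cdot>\<^sub>m X + 0 \<cdot>\<^sub>m X = c \<cdot>\<^sub>m X" "c \<cdot>\<^sub>m \<phi> X + 0 \<cdot>\<^sub>m \<phi> X = c \<cdot>\<^sub>m \<phi> X"
    by (auto intro!: eq_matI)
  moreover have "\<phi> (c \<cdot>\<^sub>m X + 0 \<cdot>\<^sub>m X) = c \<cdot>\<^sub>m \<phi> X + 0 \<cdot>\<^sub>m \<phi> X"
    using lin X unfolding linear_on_def by blast
  ultimately show ?thesis by simp
qed

lemma linear_on_zero: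
  assumes V: "mat_subspace m V" and lin: "linear_on m V \<phi>"
  shows "\<phi> (0\<^sub>m m m) = 0\<^sub>m m m"
proof -
  have "\<phi> (0\<^sub>m m m) \<in> carrier_mat m m"
    using V lin by (auto simp: linear_on_def mat_subspace_zero mat_subspace_carrier)
  moreover have "0 \<cdot>\<^sub>m X = 0\<^sub>m m m" if "X \<in> carrier_mat m m" for X :: "complex mat"
    using that by (intro eq_matI) auto
  ultimately show ?thesis
    using linear_on_smult[OF V lin mat_subspace_zero[OF V], of 0] by simp
qed

lemma mat_subspace_kernel:
  assumes V: "mat_subspace m V" and lin: "linear_on m V \<phi>"
  shows "mat_subspace m {X \<in> V. \<phi> X = 0\<^sub>m m m}"
  using V linear_on_zero[OF V lin] linear_on_add[OF lin] linear_on_smult[OF V lin]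
  by (auto simp: mat_subspace_def)

lemma linear_on_funpow_mem: "linear_on m V \<phi> \<Longrightarrow> X \<in> V \<Longrightarrow> (\<phi> ^^ n) X \<in> V"
  by (induction n) (auto simp: linear_on_def)

section \<open>Coordinates\<close>

definition entry_vec :: "complex mat list \<Rightarrow> nat \<times> nat \<Rightarrow> complex vec" where
  "entry_vec Xs p = vec (length Xs) (\<lambda>k. Xs ! k $$ p)"

text \<open>The linear combination \<^const>\<open>lincomb\<close> with a vector of coefficients, so that a change of
  coordinates becomes a matrix-vector product.\<close>

definition lincomb_vec :: "nat \<Rightarrow> complex mat list \<Rightarrow> complex vec \<Rightarrow> complex mat" where
  "lincomb_vec m Xs v = mat m m (\<lambda>p. v \<bullet> entry_vec Xs p)"

lemma entry_vec_carrier[simp]: "entry_vec Xs p \<in> carrier_vec (length Xs)"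
  by (simp add: entry_vec_def)

lemma lincomb_vec_carrier[simp]:
  "lincomb_vec m Xs v \<in> carrier_mat m m"
  "dim_row (lincomb_vec m Xs v) = m" "dim_col (lincomb_vec m Xs v) = m"
  by (auto simp: lincomb_vec_def)

lemma lincomb_vec_index[simp]:
  "i < m \<Longrightarrow> j < m \<Longrightarrow> lincomb_vec m Xs v $$ (i,j) = v \<bullet> entry_vec Xs (i,j)"
  by (simp add: lincomb_vec_def)

lemma lincomb_vec_Nil: "lincomb_vec m [] v = 0\<^sub>m m m"
  by (rule eq_matI) (auto simp: entry_vec_def scalar_prod_def)

lemma lincomb_vec_Cons:
  assumes "X \<in> carrier_mat m m"
  shows "lincomb_vec m (X # Xs) (vCons c v) = c \<cdot>\<^sub>m X + lincomb_vec m Xs v"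
  using assms by (intro eq_matI) (auto simp: entry_vec_def vec_Suc o_def)

lemma lincomb_vec_add:
  assumes "v \<in> carrier_vec (length Xs)" "w \<in> carrier_vec (length Xs)"
  shows "lincomb_vec m Xs (v + w) = lincomb_vec m Xs v + lincomb_vec m Xs w"
  by (rule eq_matI) (auto simp: add_scalar_prod_distrib[OF assms])

lemma lincomb_vec_smult:
  assumes "v \<in> carrier_vec (length Xs)"
  shows "lincomb_vec m Xs (c \<cdot>\<^sub>v v) = c \<cdot>\<^sub>m lincomb_vec m Xs v"
  by (rule eq_matI) (auto simp: smult_scalar_prod_distrib[OF assms])

lemma lincomb_vec_zero: "lincomb_vec m Xs (0\<^sub>v (length Xs)) = 0\<^sub>m m m"
  by (rule eq_matI) (auto simp: scalar_prod_left_zero[OF entry_vec_carrier])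

lemma lincomb_vec_append:
  assumes "w \<in> carrier_vec (length Xs)" "v \<in> carrier_vec (length Ys)"
  shows "lincomb_vec m (Xs @ Ys) (w @\<^sub>v v) = lincomb_vec m Xs w + lincomb_vec m Ys v"
proof -
  have "entry_vec (Xs @ Ys) p = entry_vec Xs p @\<^sub>v entry_vec Ys p" for p
    by (rule eq_vecI) (auto simp: entry_vec_def nth_append)
  thus ?thesis
    using scalar_prod_append[OF assms] by (intro eq_matI) auto
qed

lemma lincomb_vec_unit:
  assumes "set Xs \<subseteq> carrier_mat m m" "j < length Xs"
  shows "lincomb_vec m Xs (unit_vec (length Xs) j) = Xs ! j"
proof -
  have "Xs ! j \<in> carrier_mat m m" using assms by auto
  thus ?thesis using scalar_prod_left_unit[OF entry_vec_carrier assms(2)] assms(2)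
    by (intro eq_matI) (auto simp: entry_vec_def)
qed

lemma lincomb_vec_lincomb_vec_cols:
  assumes P: "P \<in> carrier_mat (length Xs) k" and v: "v \<in> carrier_vec k"
  shows "lincomb_vec m (map (\<lambda>j. lincomb_vec m Xs (col P j)) [0..<k]) v = lincomb_vec m Xs (P *\<^sub>v v)"
proof (rule eq_matI)
  let ?Ys = "map (\<lambda>j. lincomb_vec m Xs (col P j)) [0..<k]"
  fix i j assume "i < dim_row (lincomb_vec m Xs (P *\<^sub>v v))" "j < dim_col (lincomb_vec m Xs (P *\<^sub>v v))"
  hence ij: "i < m" "j < m" by auto
  let ?e = "entry_vec Xs (i,j)"
  have "entry_vec ?Ys (i,j) = P\<^sup>T *\<^sub>v ?e"
    using P ij by (intro eq_vecI) (auto simp: entry_vec_def)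
  hence "v \<bullet> entry_vec ?Ys (i,j) = (P\<^sup>T *\<^sub>v ?e) \<bullet> v"
    using P v comm_scalar_prod[of v k "P\<^sup>T *\<^sub>v ?e"] by simp
  also have "\<dots> = ?e \<bullet> (P *\<^sub>v v)" by (rule transpose_vec_mult_scalar[OF P v entry_vec_carrier])
  also have "\<dots> = (P *\<^sub>v v) \<bullet> ?e"
    using P v by (intro comm_scalar_prod[of _ "length Xs"]) auto
  finally show "lincomb_vec m ?Ys v $$ (i,j) = lincomb_vec m Xs (P *\<^sub>v v) $$ (i,j)"
    using ij by simp
qed auto

lemma lincomb_eq_lincomb_vec:
  assumes "length cs = length Xs" "set Xs \<subseteq> carrier_mat m m"
  shows "lincomb m cs Xs = lincomb_vec m Xs (vec_of_list cs)"
  using assms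
  by (induction cs Xs rule: list_induct2) (auto simp: lincomb_def lincomb_vec_Nil lincomb_vec_Cons)

lemma lincomb_list_of_vec:
  assumes "v \<in> carrier_vec (length Xs)" "set Xs \<subseteq> carrier_mat m m"
  shows "lincomb m (list_of_vec v) Xs = lincomb_vec m Xs v"
  using lincomb_eq_lincomb_vec[of "list_of_vec v" Xs m] assms by (simp add: vec_list)

lemma mspan_eq_lincomb_vec_image:
  assumes "set Xs \<subseteq> carrier_mat m m"
  shows "mspan m Xs = lincomb_vec m Xs ` carrier_vec (length Xs)"
proof (intro equalityI subsetI)
  fix X assume "X \<in> mspan m Xs"
  then obtain cs where cs: "length cs = length Xs" "X = lincomb m cs Xs"
    unfolding mspan_def by blast
  thus "X \<in> lincomb_vec m Xs ` carrier_vec (length Xs)"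
    using lincomb_eq_lincomb_vec[OF cs(1) assms] by (auto intro!: imageI carrier_vecI)
next
  fix X assume "X \<in> lincomb_vec m Xs ` carrier_vec (length Xs)"
  then obtain v where "v \<in> carrier_vec (length Xs)" "X = lincomb_vec m Xs v" by blast
  thus "X \<in> mspan m Xs"
    unfolding mspan_def using lincomb_list_of_vec[OF _ assms, symmetric]
    by (auto intro!: exI[of _ "list_of_vec v"])
qed

lemma mat_subspace_mspan:
  assumes "set Xs \<subseteq> carrier_mat m m"
  shows "mat_subspace m (mspan m Xs)"
  unfolding mat_subspace_def mspan_eq_lincomb_vec_image[OF assms]
proof (intro conjI ballI allI)
  show "0\<^sub>m m m \<in> lincomb_vec m Xs ` carrier_vec (length Xs)"
    by (rule image_eqI[of _ _ "0\<^sub>v (length Xs)"]) (auto simp: lincomb_vec_zero)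
qed (auto simp flip: lincomb_vec_add lincomb_vec_smult)

lemma set_subset_mspan:
  assumes "set Xs \<subseteq> carrier_mat m m"
  shows "set Xs \<subseteq> mspan m Xs"
proof
  fix X assume "X \<in> set Xs"
  then obtain j where "j < length Xs" "X = Xs ! j" by (auto simp: in_set_conv_nth)
  thus "X \<in> mspan m Xs" unfolding mspan_eq_lincomb_vec_image[OF assms]
    by (metis lincomb_vec_unit[OF assms] image_eqI unit_vec_carrier)
qed

lemma linear_on_lincomb_vec:
  assumes V: "mat_subspace m V" and lin: "linear_on m V \<phi>"
    and "set Xs \<subseteq> V" "v \<in> carrier_vec (length Xs)"
  shows "lincomb_vec m Xs v \<in> V \<and> \<phi> (lincomb_vec m Xs v) = lincomb_vec m (map \<phi> Xs) v"
  using assms(3,4)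
proof (induction Xs arbitrary: v)
  case Nil
  thus ?case using linear_on_zero[OF V lin] mat_subspace_zero[OF V] by (simp add: lincomb_vec_Nil)
next
  case (Cons X Xs)
  then obtain c w where v: "v = vCons c w" and w: "w \<in> carrier_vec (length Xs)" by (cases v) auto
  have X: "X \<in> V" "X \<in> carrier_mat m m" "\<phi> X \<in> carrier_mat m m"
    using Cons.prems V lin by (auto simp: linear_on_def mat_subspace_carrier)
  have IH: "lincomb_vec m Xs w \<in> V" "\<phi> (lincomb_vec m Xs w) = lincomb_vec m (map \<phi> Xs) w"
    using Cons w by auto
  have cX: "c \<cdot>\<^sub>m X \<in> V" by (rule mat_subspace_smult[OF V X(1)])
  show ?case unfolding v list.map lincomb_vec_Cons[OF X(2)] lincomb_vec_Cons[OF X(3)]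
    using IH cX linear_on_add[OF lin cX IH(1)] linear_on_smult[OF V lin X(1)]
    by (simp add: mat_subspace_add[OF V])
qed

lemma mspan_least:
  assumes V: "mat_subspace m V" and "set Xs \<subseteq> V"
  shows "mspan m Xs \<subseteq> V"
proof -
  have "linear_on m V (\<lambda>X. X)" by (simp add: linear_on_def)
  moreover have "set Xs \<subseteq> carrier_mat m m" using assms mat_subspace_carrier by blast
  ultimately show ?thesis
    using linear_on_lincomb_vec[OF V _ assms(2)] by (auto simp: mspan_eq_lincomb_vec_image)
qed

section \<open>Bases\<close>

lemma inj_on_lincomb_vec_iff:
  "inj_on (lincomb_vec m Xs) (carrier_vec (length Xs)) \<longleftrightarrow>
     (\<forall>v\<in>carrier_vec (length Xs). lincomb_vec m Xs v = 0\<^sub>m m m \<longrightarrow> v = 0\<^sub>v (length Xs))"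
    (is "?inj \<longleftrightarrow> ?kernel")
proof
  assume ?inj
  thus ?kernel by (auto simp: inj_on_def lincomb_vec_zero[symmetric])
next
  assume ?kernel
  show ?inj
  proof (rule inj_onI)
    fix v w assume v: "v \<in> carrier_vec (length Xs)" and w: "w \<in> carrier_vec (length Xs)"
      and same_value: "lincomb_vec m Xs v = lincomb_vec m Xs w"
    have "lincomb_vec m Xs (v + (-1) \<cdot>\<^sub>v w) = 0\<^sub>m m m"
      using v w same_value by (auto simp: lincomb_vec_add lincomb_vec_smult intro!: eq_matI)
    hence "v + (-1) \<cdot>\<^sub>v w = 0\<^sub>v (length Xs)" using \<open>?kernel\<close> v w by auto
    hence "(v + (-1) \<cdot>\<^sub>v w) $ i = 0" if "i < length Xs" for i using that by simp
    thus "v = w" using v w by (intro eq_vecI) auto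
  qed
qed

lemma lin_indep_iff_inj_on:
  assumes "set Xs \<subseteq> carrier_mat m m"
  shows "lin_indep m Xs \<longleftrightarrow> inj_on (lincomb_vec m Xs) (carrier_vec (length Xs))"
  unfolding inj_on_lincomb_vec_iff
proof (intro iffI ballI impI)
  fix v assume indep: "lin_indep m Xs"
    and v: "v \<in> carrier_vec (length Xs)" "lincomb_vec m Xs v = 0\<^sub>m m m"
  have "set (list_of_vec v) \<subseteq> {0}"
    using indep v lincomb_list_of_vec[OF v(1) assms] unfolding lin_indep_def by auto
  moreover have "v $ i \<in> set (list_of_vec v)" if "i < length Xs" for i
    using that v(1) nth_mem[of i "list_of_vec v"] by (simp add: list_of_vec_index)
  ultimately show "v = 0\<^sub>v (length Xs)" using v(1) by (intro eq_vecI) auto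
next
  assume kernel: "\<forall>v\<in>carrier_vec (length Xs). lincomb_vec m Xs v = 0\<^sub>m m m \<longrightarrow> v = 0\<^sub>v (length Xs)"
  show "lin_indep m Xs" unfolding lin_indep_def
  proof (intro allI impI)
    fix cs assume cs: "length cs = length Xs" "lincomb m cs Xs = 0\<^sub>m m m"
    hence "vec_of_list cs = 0\<^sub>v (length Xs)"
      using kernel lincomb_eq_lincomb_vec[OF cs(1) assms] carrier_vecI[of "vec_of_list cs"] by auto
    hence "cs = replicate (length Xs) 0" by (metis list_of_vec_0 list_vec)
    thus "set cs \<subseteq> {0}" by auto
  qed
qed

lemma is_basis_iff_bij_betw:
  "is_basis m V \<beta> \<longleftrightarrow>
     set \<beta> \<subseteq> carrier_mat m m \<and> bij_betw (lincomb_vec m \<beta>) (carrier_vec (length \<beta>)) V"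
  unfolding is_basis_def bij_betw_def using lin_indep_iff_inj_on mspan_eq_lincomb_vec_image by blast

lemma is_basis_carrier: "is_basis m V \<beta> \<Longrightarrow> set \<beta> \<subseteq> carrier_mat m m"
  by (simp add: is_basis_def)

lemma is_basis_subset: "is_basis m V \<beta> \<Longrightarrow> set \<beta> \<subseteq> V"
  unfolding is_basis_def using set_subset_mspan by auto

lemma is_basis_mat_subspace: "is_basis m V \<beta> \<Longrightarrow> mat_subspace m V"
  unfolding is_basis_def using mat_subspace_mspan by auto

lemma is_basis_lincomb_vec_mem:
  "is_basis m V \<beta> \<Longrightarrow> v \<in> carrier_vec (length \<beta>) \<Longrightarrow> lincomb_vec m \<beta> v \<in> V"
  unfolding is_basis_iff_bij_betw by (auto dest: bij_betwE)

lemma is_basis_lincomb_vec_inject: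
  assumes "is_basis m V \<beta>" "v \<in> carrier_vec (length \<beta>)" "w \<in> carrier_vec (length \<beta>)"
  shows "lincomb_vec m \<beta> v = lincomb_vec m \<beta> w \<longleftrightarrow> v = w"
  using assms unfolding is_basis_iff_bij_betw by (auto dest: bij_betw_imp_inj_on inj_onD)

lemma is_basis_lincomb_vec_eq_0_iff:
  assumes "is_basis m V \<beta>" "v \<in> carrier_vec (length \<beta>)"
  shows "lincomb_vec m \<beta> v = 0\<^sub>m m m \<longleftrightarrow> v = 0\<^sub>v (length \<beta>)"
  using is_basis_lincomb_vec_inject[OF assms zero_carrier_vec] by (simp add: lincomb_vec_zero)

lemma is_basis_obtain_lincomb_vec:
  assumes "is_basis m V \<beta>" "X \<in> V"
  obtains v where "v \<in> carrier_vec (length \<beta>)" "X = lincomb_vec m \<beta> v"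
  using assms unfolding is_basis_iff_bij_betw bij_betw_def by blast

lemma coords_lincomb_vec:
  assumes basis: "is_basis m V \<beta>" and v: "v \<in> carrier_vec (length \<beta>)"
  shows "coords m \<beta> (lincomb_vec m \<beta> v) = list_of_vec v"
  unfolding coords_def
proof (rule the_equality)
  note carrier = is_basis_carrier[OF basis]
  show "length (list_of_vec v) = length \<beta> \<and> lincomb_vec m \<beta> v = lincomb m (list_of_vec v) \<beta>"
    using lincomb_list_of_vec[OF v carrier] v by simp
  fix cs assume cs: "length cs = length \<beta> \<and> lincomb_vec m \<beta> v = lincomb m cs \<beta>"
  hence "lincomb_vec m \<beta> v = lincomb_vec m \<beta> (vec_of_list cs)"
    using lincomb_eq_lincomb_vec[OF _ carrier] by simp
  hence "v = vec_of_list cs"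
    using cs is_basis_lincomb_vec_inject[OF basis v] carrier_vecI[of "vec_of_list cs"] by auto
  thus "cs = list_of_vec v" by (simp add: list_vec)
qed

lemma is_basis_singleton:
  assumes X: "X \<in> carrier_mat m m" "X \<noteq> 0\<^sub>m m m"
  shows "is_basis m (range (\<lambda>c. c \<cdot>\<^sub>m X)) [X]"
proof -
  have multiple: "lincomb_vec m [X] (vCons c vNil) = c \<cdot>\<^sub>m X" for c
    using X by (auto simp: lincomb_vec_Cons lincomb_vec_Nil intro!: eq_matI)
  have dim1: "\<exists>c. v = vCons c vNil" if "v \<in> carrier_vec (Suc 0)" for v :: "complex vec"
    using that by (cases v) auto
  obtain i j where ij: "i < m" "j < m" "X $$ (i,j) \<noteq> 0"
    using X by (auto simp: mat_eq_iff)
  have "c = 0" if "c \<cdot>\<^sub>m X = 0\<^sub>m m m" for c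
    using arg_cong[OF that, of "\<lambda>Y. Y $$ (i,j)"] ij X(1) by simp
  hence "inj_on (lincomb_vec m [X]) (carrier_vec (length [X]))"
    unfolding inj_on_lincomb_vec_iff using dim1 by (fastforce simp: multiple zero_vec_Suc)
  moreover have "lincomb_vec m [X] ` carrier_vec (length [X]) = range (\<lambda>c. c \<cdot>\<^sub>m X)"
  proof (intro equalityI subsetI)
    fix Y assume "Y \<in> range (\<lambda>c. c \<cdot>\<^sub>m X)"
    then obtain c where "Y = lincomb_vec m [X] (vCons c vNil)" by (auto simp: multiple)
    thus "Y \<in> lincomb_vec m [X] ` carrier_vec (length [X])" by (auto intro!: imageI)
  qed (use dim1 multiple in fastforce)
  ultimately show ?thesis unfolding is_basis_iff_bij_betw bij_betw_def using X(1) by simp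
qed

lemma direct_sum_eq_0:
  assumes W: "mat_subspace m W" and V: "mat_subspace m V" and disjoint: "W \<inter> V \<subseteq> {0\<^sub>m m m}"
    and X: "X \<in> W" and Y: "Y \<in> V" and sum_zero: "X + Y = 0\<^sub>m m m"
  shows "X = 0\<^sub>m m m \<and> Y = 0\<^sub>m m m"
proof -
  have carrier: "X \<in> carrier_mat m m" "Y \<in> carrier_mat m m"
    using W V X Y by (auto intro: mat_subspace_carrier)
  have "X = (-1) \<cdot>\<^sub>m Y"
  proof (rule eq_matI)
    fix i j assume "i < dim_row ((-1) \<cdot>\<^sub>m Y)" "j < dim_col ((-1) \<cdot>\<^sub>m Y)"
    thus "X $$ (i,j) = ((-1) \<cdot>\<^sub>m Y) $$ (i,j)"
      using arg_cong[OF sum_zero, of "\<lambda>Z. Z $$ (i,j)"] carrier by (simp add: eq_neg_iff_add_eq_0)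
  qed (use carrier in auto)
  hence "X \<in> V" using mat_subspace_smult[OF V Y] by simp
  hence "X = 0\<^sub>m m m" using disjoint X by blast
  thus ?thesis using sum_zero carrier by simp
qed

lemma vec_append_cases:
  fixes u :: "'a vec"
  assumes "u \<in> carrier_vec (q + d)"
  obtains w v where "u = w @\<^sub>v v" "w \<in> carrier_vec q" "v \<in> carrier_vec d"
  using vec_first_last_append[OF assms] by (metis vec_first_carrier vec_last_carrier)

lemma lincomb_vec_append_image:
  "lincomb_vec m (Xs @ Ys) ` carrier_vec (length (Xs @ Ys))
    = {X + Y | X Y. X \<in> lincomb_vec m Xs ` carrier_vec (length Xs)
        \<and> Y \<in> lincomb_vec m Ys ` carrier_vec (length Ys)}"
    (is "?image = ?sum")
proof (intro equalityI subsetI)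
  fix Z assume "Z \<in> ?image"
  then obtain u where u: "u \<in> carrier_vec (length Xs + length Ys)" "Z = lincomb_vec m (Xs @ Ys) u"
    by auto
  from vec_append_cases[OF u(1)] obtain w v where "u = w @\<^sub>v v"
    and w: "w \<in> carrier_vec (length Xs)" and v: "v \<in> carrier_vec (length Ys)" .
  thus "Z \<in> ?sum" using lincomb_vec_append[OF w v] u(2) by blast
next
  fix Z assume "Z \<in> ?sum"
  then obtain w v where w: "w \<in> carrier_vec (length Xs)" and v: "v \<in> carrier_vec (length Ys)"
    and "Z = lincomb_vec m Xs w + lincomb_vec m Ys v" by blast
  hence "Z = lincomb_vec m (Xs @ Ys) (w @\<^sub>v v)" by (simp add: lincomb_vec_append[OF w v])
  thus "Z \<in> ?image" using w v by auto
qed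

lemma is_basis_append:
  assumes \<gamma>: "is_basis m W \<gamma>" and \<beta>: "is_basis m V \<beta>" and disjoint: "W \<inter> V \<subseteq> {0\<^sub>m m m}"
  shows "is_basis m {X + Y | X Y. X \<in> W \<and> Y \<in> V} (\<gamma> @ \<beta>)"
proof -
  have "inj_on (lincomb_vec m (\<gamma> @ \<beta>)) (carrier_vec (length (\<gamma> @ \<beta>)))"
    unfolding inj_on_lincomb_vec_iff
  proof (unfold length_append, intro ballI impI)
    fix u assume "u \<in> carrier_vec (length \<gamma> + length \<beta>)"
      and kernel: "lincomb_vec m (\<gamma> @ \<beta>) u = 0\<^sub>m m m"
    then obtain w v where u: "u = w @\<^sub>v v"
      and w: "w \<in> carrier_vec (length \<gamma>)" and v: "v \<in> carrier_vec (length \<beta>)"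
      by (elim vec_append_cases)
    have "lincomb_vec m \<gamma> w = 0\<^sub>m m m \<and> lincomb_vec m \<beta> v = 0\<^sub>m m m"
      by (rule direct_sum_eq_0[OF is_basis_mat_subspace[OF \<gamma>] is_basis_mat_subspace[OF \<beta>] disjoint
            is_basis_lincomb_vec_mem[OF \<gamma> w] is_basis_lincomb_vec_mem[OF \<beta> v]])
        (use kernel lincomb_vec_append[OF w v] u in simp)
    hence "w = 0\<^sub>v (length \<gamma>)" "v = 0\<^sub>v (length \<beta>)"
      using is_basis_lincomb_vec_eq_0_iff[OF \<gamma> w] is_basis_lincomb_vec_eq_0_iff[OF \<beta> v] by auto
    thus "u = 0\<^sub>v (length \<gamma> + length \<beta>)" unfolding u by (intro eq_vecI) auto
  qed
  moreover have "lincomb_vec m (\<gamma> @ \<beta>) ` carrier_vec (length (\<gamma> @ \<beta>)) = {X + Y | X Y. X \<in> W \<and> Y \<in> V}"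
    using \<gamma> \<beta> unfolding lincomb_vec_append_image is_basis_iff_bij_betw bij_betw_def by simp
  ultimately show ?thesis unfolding is_basis_iff_bij_betw bij_betw_def
    using is_basis_carrier[OF \<gamma>] is_basis_carrier[OF \<beta>] by simp
qed

lemma is_basis_Cons_hyperplane:
  assumes V: "mat_subspace m V" and p: "p = (i,j)" "i < m" "j < m"
    and X0: "X0 \<in> V" "X0 $$ p \<noteq> 0" and \<beta>: "is_basis m {X \<in> V. X $$ p = 0} \<beta>"
  shows "is_basis m V (X0 # \<beta>)"
proof -
  let ?W = "{X \<in> V. X $$ p = 0}" and ?line = "range (\<lambda>c. c \<cdot>\<^sub>m X0)"
  note carrier = mat_subspace_carrier[OF V]
  have disjoint: "?line \<inter> ?W \<subseteq> {0\<^sub>m m m}"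
    using X0 carrier[OF X0(1)] p by (auto intro!: eq_matI)
  have line: "is_basis m ?line [X0]"
    using carrier[OF X0(1)] X0(2) p by (intro is_basis_singleton) auto
  have "V = {X + Y | X Y. X \<in> ?line \<and> Y \<in> ?W}"
  proof (intro equalityI subsetI)
    fix X assume X: "X \<in> V"
    define c where "c = X $$ p / X0 $$ p"
    have "X - c \<cdot>\<^sub>m X0 \<in> ?W"
      using mat_subspace_minus[OF V X mat_subspace_smult[OF V X0(1)]] X0 carrier[OF X0(1)] carrier[OF X] p
      by (simp add: c_def)
    moreover have "X = c \<cdot>\<^sub>m X0 + (X - c \<cdot>\<^sub>m X0)"
      using carrier[OF X0(1)] carrier[OF X] by (intro eq_matI) auto
    ultimately show "X \<in> {X + Y | X Y. X \<in> ?line \<and> Y \<in> ?W}" by blast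
  qed (use X0(1) V in \<open>auto simp: mat_subspace_add mat_subspace_smult\<close>)
  with is_basis_append[OF line \<beta> disjoint] show ?thesis by simp
qed

text \<open>Gaussian elimination, one matrix position at a time.\<close>

lemma mat_subspace_supported_has_basis:
  assumes "finite S" "S \<subseteq> {..<m} \<times> {..<m}" "mat_subspace m V"
    "\<And>X i j. X \<in> V \<Longrightarrow> i < m \<Longrightarrow> j < m \<Longrightarrow> (i,j) \<notin> S \<Longrightarrow> X $$ (i,j) = 0"
  shows "\<exists>\<beta>. is_basis m V \<beta>"
  using assms
proof (induction S arbitrary: V rule: finite_induct)
  case empty
  have "X = 0\<^sub>m m m" if "X \<in> V" for X
    using empty.prems(3)[OF that] mat_subspace_carrier[OF empty.prems(2) that] by (intro eq_matI) auto
  hence "V = {0\<^sub>m m m}" using mat_subspace_zero[OF empty.prems(2)] by blast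
  hence "is_basis m V []" by (simp add: is_basis_def lin_indep_def mspan_def lincomb_def)
  thus ?case by blast
next
  case (insert p S)
  obtain i j where p: "p = (i,j)" "i < m" "j < m" using insert.prems(1) by (cases p) auto
  note V = insert.prems(2) and carrier = mat_subspace_carrier[OF insert.prems(2)]
  define W where "W = {X \<in> V. X $$ p = 0}"
  have W: "mat_subspace m W"
    unfolding mat_subspace_def W_def using V carrier p
    by (auto simp: mat_subspace_zero mat_subspace_add mat_subspace_smult carrier_matD[OF carrier])
  have "\<exists>\<beta>. is_basis m W \<beta>"
  proof (rule insert.IH[OF _ W])
    fix X a b assume "X \<in> W" "a < m" "b < m" "(a,b) \<notin> S"
    thus "X $$ (a,b) = 0" using insert.prems(3)[of X a b] by (cases "(a,b) = p") (auto simp: W_def)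
  qed (use insert.prems(1) in auto)
  then obtain \<beta> where \<beta>: "is_basis m W \<beta>" by blast
  show ?case
  proof (cases "W = V")
    case False
    then obtain X0 where "X0 \<in> V" "X0 $$ p \<noteq> 0" by (auto simp: W_def)
    from is_basis_Cons_hyperplane[OF V p this \<beta>[unfolded W_def]] show ?thesis by blast
  qed (use \<beta> in auto)
qed

lemma mat_subspace_obtain_basis:
  assumes "mat_subspace m V"
  obtains \<beta> where "is_basis m V \<beta>"
  using mat_subspace_supported_has_basis[of "{..<m} \<times> {..<m}" m V] assms by auto

section \<open>Matrices of linear maps\<close>

definition transition_mat :: "nat \<Rightarrow> complex mat list \<Rightarrow> complex mat list \<Rightarrow> complex mat" where
  "transition_mat m \<beta> Ys = mat (length \<beta>) (length Ys) (\<lambda>(i,j). coords m \<beta> (Ys ! j) ! i)"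

lemma transition_mat_carrier[simp]: "transition_mat m \<beta> Ys \<in> carrier_mat (length \<beta>) (length Ys)"
  by (simp add: transition_mat_def)

lemma map_mat_carrier[simp]: "map_mat m \<beta> \<phi> \<in> carrier_mat (length \<beta>) (length \<beta>)"
  by (simp add: map_mat_def)

lemma map_mat_dim[simp]:
  "dim_row (map_mat m \<beta> \<phi>) = length \<beta>" "dim_col (map_mat m \<beta> \<phi>) = length \<beta>"
  by (simp_all add: map_mat_def)

lemma map_mat_eq_transition_mat: "map_mat m \<beta> \<phi> = transition_mat m \<beta> (map \<phi> \<beta>)"
  by (rule eq_matI) (auto simp: map_mat_def transition_mat_def)

lemma lincomb_vec_transition_mat:
  assumes basis: "is_basis m V \<beta>" and Ys: "set Ys \<subseteq> V" and v: "v \<in> carrier_vec (length Ys)"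
  shows "lincomb_vec m Ys v = lincomb_vec m \<beta> (transition_mat m \<beta> Ys *\<^sub>v v)"
proof -
  have "Ys ! j = lincomb_vec m \<beta> (col (transition_mat m \<beta> Ys) j)" if j: "j < length Ys" for j
  proof -
    obtain w where w: "w \<in> carrier_vec (length \<beta>)" "Ys ! j = lincomb_vec m \<beta> w"
      using is_basis_obtain_lincomb_vec[OF basis, of "Ys ! j"] Ys j by (auto simp: subset_iff)
    have "col (transition_mat m \<beta> Ys) j = w"
      using j w coords_lincomb_vec[OF basis w(1)]
      by (intro eq_vecI) (auto simp: transition_mat_def list_of_vec_index)
    thus ?thesis using w(2) by simp
  qed
  hence "Ys = map (\<lambda>j. lincomb_vec m \<beta> (col (transition_mat m \<beta> Ys) j)) [0..<length Ys]"
    by (intro nth_equalityI) auto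
  thus ?thesis using lincomb_vec_lincomb_vec_cols[OF transition_mat_carrier v] by metis
qed

lemma map_mat_mult_vec:
  assumes basis: "is_basis m V \<beta>" and lin: "linear_on m V \<phi>" and v: "v \<in> carrier_vec (length \<beta>)"
  shows "\<phi> (lincomb_vec m \<beta> v) = lincomb_vec m \<beta> (map_mat m \<beta> \<phi> *\<^sub>v v)"
proof -
  have "set (map \<phi> \<beta>) \<subseteq> V" using is_basis_subset[OF basis] lin by (auto simp: linear_on_def)
  from lincomb_vec_transition_mat[OF basis this, of v] show ?thesis
    using linear_on_lincomb_vec[OF is_basis_mat_subspace[OF basis] lin is_basis_subset[OF basis] v] v
    by (simp add: map_mat_eq_transition_mat)
qed

lemma map_mat_eqI:
  assumes basis: "is_basis m V \<beta>" and A: "A \<in> carrier_mat (length \<beta>) (length \<beta>)"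
    and action: "\<And>v. v \<in> carrier_vec (length \<beta>) \<Longrightarrow> \<phi> (lincomb_vec m \<beta> v) = lincomb_vec m \<beta> (A *\<^sub>v v)"
  shows "map_mat m \<beta> \<phi> = A"
proof (rule eq_matI)
  fix i j assume "i < dim_row A" "j < dim_col A"
  hence ij: "i < length \<beta>" "j < length \<beta>" using A by auto
  have "\<phi> (\<beta> ! j) = lincomb_vec m \<beta> (A *\<^sub>v unit_vec (length \<beta>) j)"
    using action[of "unit_vec (length \<beta>) j"] lincomb_vec_unit[OF is_basis_carrier[OF basis] ij(2)] by simp
  hence "coords m \<beta> (\<phi> (\<beta> ! j)) = list_of_vec (A *\<^sub>v unit_vec (length \<beta>) j)"
    using coords_lincomb_vec[OF basis, of "A *\<^sub>v unit_vec (length \<beta>) j"] A by simp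
  thus "map_mat m \<beta> \<phi> $$ (i,j) = A $$ (i,j)"
    using A ij by (simp add: map_mat_def list_of_vec_index)
qed (use A in auto)

lemma linear_on_comp: "linear_on m V \<phi> \<Longrightarrow> linear_on m V \<psi> \<Longrightarrow> linear_on m V (\<phi> \<circ> \<psi>)"
  by (simp add: linear_on_def)

lemma linear_on_funpow: "linear_on m V \<phi> \<Longrightarrow> linear_on m V (\<phi> ^^ n)"
  by (induction n) (auto simp: linear_on_comp linear_on_def)

lemma map_mat_comp:
  assumes basis: "is_basis m V \<beta>" and "linear_on m V \<phi>" "linear_on m V \<psi>"
  shows "map_mat m \<beta> (\<phi> \<circ> \<psi>) = map_mat m \<beta> \<phi> * map_mat m \<beta> \<psi>"
proof (rule map_mat_eqI[OF basis])
  fix v :: "complex vec" assume v: "v \<in> carrier_vec (length \<beta>)"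
  have "map_mat m \<beta> \<psi> *\<^sub>v v \<in> carrier_vec (length \<beta>)" by (rule mult_mat_vec_carrier[OF map_mat_carrier v])
  thus "(\<phi> \<circ> \<psi>) (lincomb_vec m \<beta> v) = lincomb_vec m \<beta> (map_mat m \<beta> \<phi> * map_mat m \<beta> \<psi> *\<^sub>v v)"
    using map_mat_mult_vec[OF basis assms(2)] map_mat_mult_vec[OF basis assms(3) v]
      assoc_mult_mat_vec[OF map_mat_carrier map_mat_carrier v] by simp
qed (rule mult_carrier_mat[OF map_mat_carrier map_mat_carrier])

lemma map_mat_funpow:
  assumes basis: "is_basis m V \<beta>" and lin: "linear_on m V \<phi>"
  shows "map_mat m \<beta> (\<phi> ^^ n) = map_mat m \<beta> \<phi> ^\<^sub>m n"
proof (induction n)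
  case 0
  show ?case by (rule map_mat_eqI[OF basis]) auto
next
  case (Suc n)
  thus ?case using map_mat_comp[OF basis linear_on_funpow[OF lin] lin]
    by (simp only: funpow_Suc_right pow_mat.simps)
qed

lemma map_mat_cong: "(\<And>X. X \<in> set \<beta> \<Longrightarrow> \<phi> X = \<psi> X) \<Longrightarrow> map_mat m \<beta> \<phi> = map_mat m \<beta> \<psi>"
  by (rule eq_matI) (auto simp: map_mat_def)

lemma map_mat_append:
  assumes \<gamma>: "is_basis m W \<gamma>" and \<beta>: "is_basis m V \<beta>" and disjoint: "W \<inter> V \<subseteq> {0\<^sub>m m m}"
    and U: "U = {X + Y | X Y. X \<in> W \<and> Y \<in> V}" and lin: "linear_on m U \<phi>"
    and invariant: "linear_on m W \<phi>" "linear_on m V \<phi>"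
  shows "map_mat m (\<gamma> @ \<beta>) \<phi> = four_block_mat (map_mat m \<gamma> \<phi>) (0\<^sub>m (length \<gamma>) (length \<beta>))
    (0\<^sub>m (length \<beta>) (length \<gamma>)) (map_mat m \<beta> \<phi>)"
    (is "_ = ?B")
proof (rule map_mat_eqI[OF is_basis_append[OF \<gamma> \<beta> disjoint]])
  show "?B \<in> carrier_mat (length (\<gamma> @ \<beta>)) (length (\<gamma> @ \<beta>))"
    using four_block_carrier_mat[OF map_mat_carrier map_mat_carrier] by simp
  fix u :: "complex vec" assume "u \<in> carrier_vec (length (\<gamma> @ \<beta>))"
  hence "u \<in> carrier_vec (length \<gamma> + length \<beta>)" by simp
  then obtain w v where u: "u = w @\<^sub>v v"
    and w: "w \<in> carrier_vec (length \<gamma>)" and v: "v \<in> carrier_vec (length \<beta>)"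
    by (elim vec_append_cases)
  have Aw: "map_mat m \<gamma> \<phi> *\<^sub>v w \<in> carrier_vec (length \<gamma>)" and Av: "map_mat m \<beta> \<phi> *\<^sub>v v \<in> carrier_vec (length \<beta>)"
    using mult_mat_vec_carrier[OF map_mat_carrier] w v by auto
  let ?X = "lincomb_vec m \<gamma> w" and ?Y = "lincomb_vec m \<beta> v"
  have X: "?X \<in> W" and Y: "?Y \<in> V" using is_basis_lincomb_vec_mem[OF \<gamma> w] is_basis_lincomb_vec_mem[OF \<beta> v] .
  have "0\<^sub>m m m \<in> W" "0\<^sub>m m m \<in> V"
    using \<gamma> \<beta> by (auto intro: mat_subspace_zero is_basis_mat_subspace)
  hence "?X + 0\<^sub>m m m \<in> U" "0\<^sub>m m m + ?Y \<in> U" using X Y unfolding U by blast+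
  hence "\<phi> (?X + ?Y) = \<phi> ?X + \<phi> ?Y" by (intro linear_on_add[OF lin]) auto
  also have "\<dots> = lincomb_vec m (\<gamma> @ \<beta>) ((map_mat m \<gamma> \<phi> *\<^sub>v w) @\<^sub>v (map_mat m \<beta> \<phi> *\<^sub>v v))"
    unfolding map_mat_mult_vec[OF \<gamma> invariant(1) w] map_mat_mult_vec[OF \<beta> invariant(2) v]
    by (rule lincomb_vec_append[OF Aw Av, symmetric])
  also have "(map_mat m \<gamma> \<phi> *\<^sub>v w) @\<^sub>v (map_mat m \<beta> \<phi> *\<^sub>v v) = ?B *\<^sub>v u"
    unfolding u
      four_block_mat_mult_vec[OF map_mat_carrier zero_carrier_mat zero_carrier_mat map_mat_carrier w v]
    using w v Aw Av by (auto intro!: arg_cong2[of _ _ _ _ append_vec] eq_vecI)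
  finally show "\<phi> (lincomb_vec m (\<gamma> @ \<beta>) u) = lincomb_vec m (\<gamma> @ \<beta>) (?B *\<^sub>v u)"
    unfolding u lincomb_vec_append[OF w v] .
qed

section \<open>Change of basis\<close>

lemma mat_eqI_mult_vec:
  fixes A B :: "'a :: semiring_1 mat"
  assumes A: "A \<in> carrier_mat n k" and B: "B \<in> carrier_mat n k"
    and eq: "\<And>v. v \<in> carrier_vec k \<Longrightarrow> A *\<^sub>v v = B *\<^sub>v v"
  shows "A = B"
proof (rule eq_matI)
  fix i j assume ij: "i < dim_row B" "j < dim_col B"
  have "(A *\<^sub>v unit_vec k j) $ i = (B *\<^sub>v unit_vec k j) $ i" using eq by simp
  thus "A $$ (i,j) = B $$ (i,j)" using A B ij by auto
qed (use A B in auto)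

lemma mutually_inverse_mat_dim_eq:
  fixes P Q :: "'a :: {comm_ring_1, ring_char_0} mat"
  assumes P: "P \<in> carrier_mat n k" and Q: "Q \<in> carrier_mat k n"
    and PQ: "P * Q = 1\<^sub>m n" and QP: "Q * P = 1\<^sub>m k"
  shows "n = k"
proof -
  have "of_nat n = (\<Sum>i<n. (P * Q) $$ (i,i))" unfolding PQ by simp
  also have "\<dots> = (\<Sum>i<n. \<Sum>j<k. P $$ (i,j) * Q $$ (j,i))"
    using P Q by (intro sum.cong refl) (auto simp: scalar_prod_def atLeast0LessThan)
  also have "\<dots> = (\<Sum>j<k. \<Sum>i<n. P $$ (i,j) * Q $$ (j,i))" by (rule sum.swap)
  also have "\<dots> = (\<Sum>j<k. (Q * P) $$ (j,j))"
    using P Q by (intro sum.cong refl) (auto simp: scalar_prod_def atLeast0LessThan mult.commute)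
  also have "\<dots> = of_nat k" unfolding QP by simp
  finally show ?thesis by simp
qed

lemma transition_mat_mult:
  assumes \<beta>: "is_basis m V \<beta>" and \<gamma>: "is_basis m V \<gamma>"
  shows "transition_mat m \<beta> \<gamma> * transition_mat m \<gamma> \<beta> = 1\<^sub>m (length \<beta>)"
proof (rule mat_eqI_mult_vec[of _ "length \<beta>" "length \<beta>"])
  fix v :: "complex vec" assume v: "v \<in> carrier_vec (length \<beta>)"
  let ?P = "transition_mat m \<beta> \<gamma>" and ?Q = "transition_mat m \<gamma> \<beta>"
  have Qv: "?Q *\<^sub>v v \<in> carrier_vec (length \<gamma>)" by (rule mult_mat_vec_carrier[OF transition_mat_carrier v])
  have "lincomb_vec m \<beta> (?P *\<^sub>v (?Q *\<^sub>v v)) = lincomb_vec m \<beta> v"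
    using lincomb_vec_transition_mat[OF \<beta> is_basis_subset[OF \<gamma>] Qv]
      lincomb_vec_transition_mat[OF \<gamma> is_basis_subset[OF \<beta>] v] by simp
  hence "?P *\<^sub>v (?Q *\<^sub>v v) = v"
    using is_basis_lincomb_vec_inject[OF \<beta> _ v] mult_mat_vec_carrier[OF transition_mat_carrier Qv] by blast
  thus "?P * ?Q *\<^sub>v v = 1\<^sub>m (length \<beta>) *\<^sub>v v"
    using assoc_mult_mat_vec[OF transition_mat_carrier transition_mat_carrier v] v by simp
qed (auto intro: mult_carrier_mat[OF transition_mat_carrier transition_mat_carrier])

lemma map_mat_change_basis:
  assumes \<beta>: "is_basis m V \<beta>" and \<gamma>: "is_basis m V \<gamma>" and lin: "linear_on m V \<phi>"
    and P: "P \<in> carrier_mat (length \<beta>) (length \<gamma>)" and Q: "Q \<in> carrier_mat (length \<gamma>) (length \<beta>)"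
    and PQ: "P * Q = 1\<^sub>m (length \<beta>)"
    and change: "\<And>v. v \<in> carrier_vec (length \<gamma>) \<Longrightarrow> lincomb_vec m \<gamma> v = lincomb_vec m \<beta> (P *\<^sub>v v)"
  shows "map_mat m \<gamma> \<phi> = Q * map_mat m \<beta> \<phi> * P"
proof (rule map_mat_eqI[OF \<gamma>])
  let ?A = "map_mat m \<beta> \<phi>"
  have A: "?A \<in> carrier_mat (length \<beta>) (length \<beta>)" by simp
  show "Q * ?A * P \<in> carrier_mat (length \<gamma>) (length \<gamma>)" using P Q A by auto
  fix v :: "complex vec" assume v: "v \<in> carrier_vec (length \<gamma>)"
  have Pv: "P *\<^sub>v v \<in> carrier_vec (length \<beta>)" by (rule mult_mat_vec_carrier[OF P v])
  have APv: "?A *\<^sub>v (P *\<^sub>v v) \<in> carrier_vec (length \<beta>)" by (rule mult_mat_vec_carrier[OF A Pv])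
  have "P *\<^sub>v (Q *\<^sub>v (?A *\<^sub>v (P *\<^sub>v v))) = ?A *\<^sub>v (P *\<^sub>v v)"
    using assoc_mult_mat_vec[OF P Q APv] PQ APv by simp
  moreover have "Q *\<^sub>v (?A *\<^sub>v (P *\<^sub>v v)) = Q * ?A * P *\<^sub>v v"
    using assoc_mult_mat_vec[OF mult_carrier_mat[OF Q A] P v] assoc_mult_mat_vec[OF Q A Pv] by simp
  ultimately show "\<phi> (lincomb_vec m \<gamma> v) = lincomb_vec m \<gamma> (Q * ?A * P *\<^sub>v v)"
    using change[OF v] change[of "Q * ?A * P *\<^sub>v v"] map_mat_mult_vec[OF \<beta> lin Pv]
      mult_mat_vec_carrier[OF Q APv] by simp
qed

lemma map_mat_similar:
  assumes \<beta>: "is_basis m V \<beta>" and \<gamma>: "is_basis m V \<gamma>" and lin: "linear_on m V \<phi>"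
  shows "similar_mat (map_mat m \<gamma> \<phi>) (map_mat m \<beta> \<phi>)"
proof -
  let ?P = "transition_mat m \<beta> \<gamma>" and ?Q = "transition_mat m \<gamma> \<beta>"
  note PQ = transition_mat_mult[OF \<beta> \<gamma>] and QP = transition_mat_mult[OF \<gamma> \<beta>]
  have length: "length \<beta> = length \<gamma>"
    by (rule mutually_inverse_mat_dim_eq[OF transition_mat_carrier transition_mat_carrier PQ QP])
  have "map_mat m \<gamma> \<phi> = ?Q * map_mat m \<beta> \<phi> * ?P"
    by (rule map_mat_change_basis[OF \<beta> \<gamma> lin transition_mat_carrier transition_mat_carrier PQ])
      (rule lincomb_vec_transition_mat[OF \<beta> is_basis_subset[OF \<gamma>]])
  thus ?thesis using PQ QP transition_mat_carrier[of m \<beta> \<gamma>] transition_mat_carrier[of m \<gamma> \<beta>]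
    map_mat_carrier[of m \<beta> \<phi>] map_mat_carrier[of m \<gamma> \<phi>] unfolding length
    by (intro similar_matI[of _ _ ?Q ?P "length \<gamma>"]) auto
qed

lemma is_basis_lincomb_vec_cols:
  assumes basis: "is_basis m V \<beta>"
    and P: "P \<in> carrier_mat (length \<beta>) (length \<beta>)" and Q: "Q \<in> carrier_mat (length \<beta>) (length \<beta>)"
    and PQ: "P * Q = 1\<^sub>m (length \<beta>)" and QP: "Q * P = 1\<^sub>m (length \<beta>)"
  shows "is_basis m V (map (\<lambda>j. lincomb_vec m \<beta> (col P j)) [0..<length \<beta>])" (is "is_basis m V ?\<gamma>")
proof -
  let ?C = "carrier_vec (length \<beta>) :: complex vec set"
  have "bij_betw (\<lambda>v. P *\<^sub>v v) ?C ?C"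
  proof (rule bij_betw_byWitness[where f' = "\<lambda>v. Q *\<^sub>v v"])
    show "\<forall>v\<in>?C. Q *\<^sub>v (P *\<^sub>v v) = v"
      using assoc_mult_mat_vec[OF Q P] QP by (metis one_mult_mat_vec)
    show "\<forall>v\<in>?C. P *\<^sub>v (Q *\<^sub>v v) = v"
      using assoc_mult_mat_vec[OF P Q] PQ by (metis one_mult_mat_vec)
  qed (use P Q in auto)
  hence "bij_betw (lincomb_vec m \<beta> \<circ> (\<lambda>v. P *\<^sub>v v)) ?C V"
    using basis unfolding is_basis_iff_bij_betw by (blast intro: bij_betw_trans)
  hence "bij_betw (lincomb_vec m ?\<gamma>) ?C V"
    using lincomb_vec_lincomb_vec_cols[OF P]
    by (subst bij_betw_cong[where g = "lincomb_vec m \<beta> \<circ> (\<lambda>v. P *\<^sub>v v)"]) auto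
  thus ?thesis unfolding is_basis_iff_bij_betw by auto
qed

lemma jordan_basis_exists:
  assumes basis: "is_basis m V \<beta>" and lin: "linear_on m V \<phi>"
  shows "\<exists>\<gamma>. jordan_basis m V \<phi> \<gamma>"
proof -
  define d where "d = length \<beta>"
  define A where "A = map_mat m \<beta> \<phi>"
  have A: "A \<in> carrier_mat d d" by (simp add: A_def d_def)
  obtain as where "char_poly A = (\<Prod>a\<leftarrow>as. [:- a, 1:])"
    using char_poly_factorized[OF A] by auto
  then obtain n_as where "similar_mat A (jordan_matrix n_as)"
    using jordan_nf_exists[OF A] unfolding jordan_nf_def by blast
  then obtain d' P Q where carrier: "{A, jordan_matrix n_as, P, Q} \<subseteq> carrier_mat d' d'"
    and PQ: "P * Q = 1\<^sub>m d'" and QP: "Q * P = 1\<^sub>m d'" and APQ: "A = P * jordan_matrix n_as * Q"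
    using similar_matD by blast
  have d': "d' = d" using carrier A by auto
  have P: "P \<in> carrier_mat d d" and Q: "Q \<in> carrier_mat d d" and J: "jordan_matrix n_as \<in> carrier_mat d d"
    using carrier unfolding d' by auto
  note PQ = PQ[unfolded d'] and QP = QP[unfolded d']
  define \<gamma> where "\<gamma> = map (\<lambda>j. lincomb_vec m \<beta> (col P j)) [0..<d]"
  have length: "length \<gamma> = d" by (simp add: \<gamma>_def)
  have \<gamma>: "is_basis m V \<gamma>"
    using is_basis_lincomb_vec_cols[OF basis] P Q PQ QP by (simp add: \<gamma>_def d_def)
  have "map_mat m \<gamma> \<phi> = Q * A * P" unfolding A_def
  proof (rule map_mat_change_basis[OF basis \<gamma> lin, unfolded length d_def[symmetric], OF P Q PQ])
    fix v :: "complex vec" assume "v \<in> carrier_vec d"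
    thus "lincomb_vec m \<gamma> v = lincomb_vec m \<beta> (P *\<^sub>v v)"
      unfolding \<gamma>_def using P by (intro lincomb_vec_lincomb_vec_cols) (simp_all add: d_def)
  qed
  also have "\<dots> = Q * P * jordan_matrix n_as * (Q * P)"
    unfolding APQ using P Q J by (simp add: assoc_mult_mat[of _ d d _ d _ d])
  also have "\<dots> = jordan_matrix n_as" unfolding QP left_mult_one_mat[OF J] right_mult_one_mat[OF J] ..
  finally show ?thesis using \<gamma> unfolding jordan_basis_def by blast
qed

section \<open>Spectral radius and norm in a basis\<close>

lemma eigenvalue_map_mat_iff:
  assumes basis: "is_basis m V \<beta>" and lin: "linear_on m V \<phi>"
  shows "eigenvalue (map_mat m \<beta> \<phi>) c \<longleftrightarrow>
    (\<exists>X\<in>V. X \<noteq> 0\<^sub>m (dim_row X) (dim_col X) \<and> \<phi> X = c \<cdot>\<^sub>m X)"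
proof -
  have eigenvector: "eigenvector (map_mat m \<beta> \<phi>) v c \<longleftrightarrow>
      lincomb_vec m \<beta> v \<noteq> 0\<^sub>m m m \<and> \<phi> (lincomb_vec m \<beta> v) = c \<cdot>\<^sub>m lincomb_vec m \<beta> v"
    if v: "v \<in> carrier_vec (length \<beta>)" for v
    using v is_basis_lincomb_vec_inject[OF basis mult_mat_vec_carrier[OF map_mat_carrier v], of "c \<cdot>\<^sub>v v"]
      is_basis_lincomb_vec_eq_0_iff[OF basis v] map_mat_mult_vec[OF basis lin v]
    by (simp add: eigenvector_def lincomb_vec_smult)
  show ?thesis
  proof
    assume "eigenvalue (map_mat m \<beta> \<phi>) c"
    then obtain v where v: "eigenvector (map_mat m \<beta> \<phi>) v c" by (auto simp: eigenvalue_def)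
    hence carrier: "v \<in> carrier_vec (length \<beta>)" by (simp add: eigenvector_def)
    show "\<exists>X\<in>V. X \<noteq> 0\<^sub>m (dim_row X) (dim_col X) \<and> \<phi> X = c \<cdot>\<^sub>m X"
      using v eigenvector[OF carrier] is_basis_lincomb_vec_mem[OF basis carrier]
      by (intro bexI[of _ "lincomb_vec m \<beta> v"]) auto
  next
    assume "\<exists>X\<in>V. X \<noteq> 0\<^sub>m (dim_row X) (dim_col X) \<and> \<phi> X = c \<cdot>\<^sub>m X"
    then obtain X where X: "X \<in> V" "X \<noteq> 0\<^sub>m (dim_row X) (dim_col X)" "\<phi> X = c \<cdot>\<^sub>m X" by blast
    from is_basis_obtain_lincomb_vec[OF basis X(1)] obtain v
      where v: "v \<in> carrier_vec (length \<beta>)" "X = lincomb_vec m \<beta> v" .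
    show "eigenvalue (map_mat m \<beta> \<phi>) c"
      using eigenvector[OF v(1)] X(2,3) v(2) unfolding eigenvalue_def by auto
  qed
qed

lemma map_spectral_radius_eq_spectral_radius:
  assumes basis: "is_basis m V \<beta>" "\<beta> \<noteq> []" and lin: "linear_on m V \<phi>"
  shows "map_spectral_radius V \<phi> = spectral_radius (map_mat m \<beta> \<phi>)"
proof -
  have "{cmod c | c. \<exists>X\<in>V. X \<noteq> 0\<^sub>m (dim_row X) (dim_col X) \<and> \<phi> X = c \<cdot>\<^sub>m X}
      = cmod ` spectrum (map_mat m \<beta> \<phi>)"
    using eigenvalue_map_mat_iff[OF basis(1) lin] by (auto simp: spectrum_def)
  moreover have "finite (spectrum (map_mat m \<beta> \<phi>))" "spectrum (map_mat m \<beta> \<phi>) \<noteq> {}"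
    using card_finite_spectrum(1)[OF map_mat_carrier] spectrum_non_empty[OF map_mat_carrier] basis(2)
    by auto
  ultimately show ?thesis
    unfolding map_spectral_radius_def spectral_radius_def by (simp add: cSup_eq_Max)
qed

lemma beta_norm_le_iff:
  assumes "\<beta> \<noteq> []"
  shows "beta_norm m \<beta> \<psi> \<le> c \<longleftrightarrow> norm_bound (map_mat m \<beta> \<psi>) c"
proof -
  have "finite {cmod (map_mat m \<beta> \<psi> $$ (i,j)) | i j. i < length \<beta> \<and> j < length \<beta>}"
    by (rule finite_image_set2) auto
  moreover have "{cmod (map_mat m \<beta> \<psi> $$ (i,j)) | i j. i < length \<beta> \<and> j < length \<beta>} \<noteq> {}"
    using assms by blast
  ultimately show ?thesis
    unfolding beta_norm_def norm_bound_def by (auto simp: Max_le_iff)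
qed

lemma beta_norm_comp_le:
  assumes basis: "is_basis m V \<beta>" "\<beta> \<noteq> []" and lin: "linear_on m V \<phi>" "linear_on m V \<psi>"
  shows "beta_norm m \<beta> (\<phi> \<circ> \<psi>) \<le> beta_norm m \<beta> \<phi> * beta_norm m \<beta> \<psi> * length \<beta>"
  unfolding beta_norm_le_iff[OF basis(2)] map_mat_comp[OF basis(1) lin]
  by (rule norm_bound_mult[OF map_mat_carrier map_mat_carrier])
    (simp_all flip: beta_norm_le_iff[OF basis(2)])

section \<open>The maximal part\<close>

definition cesaro_map_tendsto :: "nat \<Rightarrow> complex mat set \<Rightarrow> (nat \<Rightarrow> complex mat \<Rightarrow> complex mat)
    \<Rightarrow> (nat \<Rightarrow> real) \<Rightarrow> (complex mat \<Rightarrow> complex mat) \<Rightarrow> bool" where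
  "cesaro_map_tendsto m V F D \<psi> \<longleftrightarrow>
     (\<forall>X\<in>V. \<forall>i<m. \<forall>j<m. cesaro_tendsto (\<lambda>n. F n X $$ (i,j) / complex_of_real (D n)) (\<psi> X $$ (i,j)))"

lemma cesaro_map_tendstoD:
  "cesaro_map_tendsto m V F D \<psi> \<Longrightarrow> X \<in> V \<Longrightarrow> i < m \<Longrightarrow> j < m
    \<Longrightarrow> cesaro_tendsto (\<lambda>n. F n X $$ (i,j) / complex_of_real (D n)) (\<psi> X $$ (i,j))"
  by (simp add: cesaro_map_tendsto_def)

lemma cesaro_map_tendsto_unique:
  assumes "cesaro_map_tendsto m V F D \<psi>" "cesaro_map_tendsto m V F D \<psi>'"
    and "X \<in> V" "\<psi> X \<in> carrier_mat m m" "\<psi>' X \<in> carrier_mat m m"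
  shows "\<psi> X = \<psi>' X"
proof (rule eq_matI)
  fix i j assume "i < dim_row (\<psi>' X)" "j < dim_col (\<psi>' X)"
  thus "\<psi> X $$ (i,j) = \<psi>' X $$ (i,j)"
    using assms by (intro cesaro_tendsto_unique[OF cesaro_map_tendstoD cesaro_map_tendstoD]) auto
qed (use assms in auto)

lemma cesaro_map_tendsto_cong:
  assumes "cesaro_map_tendsto m V F D \<psi>"
    and "\<And>n X. n \<ge> 1 \<Longrightarrow> X \<in> V \<Longrightarrow> F' n X = F n X" "\<And>n. n \<ge> 1 \<Longrightarrow> D' n = D n"
  shows "cesaro_map_tendsto m V F' D' \<psi>"
  unfolding cesaro_map_tendsto_def
proof (intro ballI allI impI)
  fix X i j assume X: "X \<in> V" and ij: "i < m" "j < m"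
  have "eventually (\<lambda>n. F' n X $$ (i,j) / complex_of_real (D' n)
      = F n X $$ (i,j) / complex_of_real (D n)) sequentially"
    using eventually_ge_at_top[of 1] by eventually_elim (simp add: assms(2,3) X)
  thus "cesaro_tendsto (\<lambda>n. F' n X $$ (i,j) / complex_of_real (D' n)) (\<psi> X $$ (i,j))"
    by (rule cesaro_tendsto_eventually_cong[OF cesaro_map_tendstoD[OF assms(1) X ij]])
qed

lemma cesaro_tendsto_sum_divide:
  assumes "\<And>x. x \<in> S \<Longrightarrow> cesaro_tendsto (\<lambda>n. g x n / D n) (l x)"
  shows "cesaro_tendsto (\<lambda>n. (\<Sum>x\<in>S. c x * g x n) / D n) (\<Sum>x\<in>S. c x * l x)"
proof -
  have "(\<Sum>x\<in>S. c x * g x n) / D n = (\<Sum>x\<in>S. c x * (g x n / D n))" for n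
    by (simp add: sum_divide_distrib)
  thus ?thesis by (simp only:) (intro cesaro_tendsto_sum cesaro_tendsto_mult_left assms)
qed

locale jordan_coordinates =
  fixes m :: nat and V :: "complex mat set" and \<phi> :: "complex mat \<Rightarrow> complex mat"
    and \<beta> :: "complex mat list" and n_as :: "(nat \<times> complex) list"
  assumes basis: "is_basis m V \<beta>" and linear: "linear_on m V \<phi>"
    and jordan: "map_mat m \<beta> \<phi> = jordan_matrix n_as"
begin

lemma length_basis: "sum_list (map fst n_as) = length \<beta>"
  by (metis jordan jordan_matrix_dim(1) map_mat_dim(1))

lemma basis_nonempty_iff: "\<beta> \<noteq> [] \<longleftrightarrow> jordan_indices n_as \<noteq> {}"
  by (simp add: jordan_indices_nonempty_iff length_basis)

lemma is_jordan_basis: "jordan_basis m V \<phi> \<beta>"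
  using basis jordan by (auto simp: jordan_basis_def)

lemma spectral_radius_pos_obtain_index:
  assumes "map_spectral_radius V \<phi> > 0" "\<beta> \<noteq> []"
  obtains a where "(0,a) \<in> jordan_indices n_as" "a \<noteq> 0"
proof -
  have "spectral_radius (map_mat m \<beta> \<phi>) \<in> cmod ` spectrum (map_mat m \<beta> \<phi>)"
    using assms(2) by (intro spectral_radius_mem_max(1)[OF map_mat_carrier]) simp
  then obtain a where "eigenvalue (jordan_matrix n_as) a" "cmod a = map_spectral_radius V \<phi>"
    unfolding map_spectral_radius_eq_spectral_radius[OF basis assms(2) linear] spectrum_def jordan by auto
  thus ?thesis using assms(1) by (intro that[of a]) (auto simp: eigenvalue_jordan_matrix_iff)
qed

lemma beta_norm_funpow:
  assumes jordan_basis: "jordan_basis m V \<phi> \<gamma>" and nonempty: "\<beta> \<noteq> []"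
  shows "beta_norm m \<gamma> (\<phi> ^^ n) = jordan_growth (jordan_indices n_as) n"
proof -
  from jordan_basis obtain n_bs where \<gamma>: "jordan_coordinates m V \<phi> \<gamma> n_bs"
    using linear by (auto simp: jordan_basis_def jordan_coordinates_def)
  interpret other: jordan_coordinates m V \<phi> \<gamma> n_bs by (rule \<gamma>)
  have indices: "jordan_indices n_bs = jordan_indices n_as"
    using map_mat_similar[OF basis other.basis linear] unfolding jordan other.jordan
    by (rule jordan_indices_similar)
  hence "\<gamma> \<noteq> []" using nonempty unfolding basis_nonempty_iff other.basis_nonempty_iff by simp
  hence "beta_norm m \<gamma> (\<phi> ^^ n) \<le> c \<longleftrightarrow> jordan_growth (jordan_indices n_as) n \<le> c" for c
    unfolding indices[symmetric]
    by (simp add: beta_norm_le_iff map_mat_funpow[OF other.basis linear] other.jordan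
        norm_bound_jordan_matrix_pow_iff other.length_basis)
  thus ?thesis by (metis order.antisym order_refl)
qed

lemma funpow_index_expansion:
  assumes v: "v \<in> carrier_vec (length \<beta>)" and ij: "i < m" "j < m"
  shows "(\<phi> ^^ n) (lincomb_vec m \<beta> v) $$ (i,j)
    = (\<Sum>(p,q)\<in>{..<length \<beta>} \<times> {..<length \<beta>}. (v $ q * \<beta> ! p $$ (i,j)) * (jordan_matrix n_as ^\<^sub>m n) $$ (p,q))"
proof -
  let ?J = "jordan_matrix n_as ^\<^sub>m n" and ?d = "length \<beta>"
  have J: "?J \<in> carrier_mat ?d ?d" using jordan_matrix_pow_carrier[of n_as n] by (simp add: length_basis)
  have "(\<phi> ^^ n) (lincomb_vec m \<beta> v) = lincomb_vec m \<beta> (?J *\<^sub>v v)"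
    using map_mat_mult_vec[OF basis linear_on_funpow[OF linear] v] map_mat_funpow[OF basis linear]
    by (simp add: jordan)
  hence "(\<phi> ^^ n) (lincomb_vec m \<beta> v) $$ (i,j) = (\<Sum>p<?d. (\<Sum>q<?d. ?J $$ (p,q) * v $ q) * \<beta> ! p $$ (i,j))"
    using ij v carrier_matD[OF J] by (simp add: scalar_prod_def entry_vec_def atLeast0LessThan)
  thus ?thesis by (simp add: sum_distrib_left sum_distrib_right sum.cartesian_product mult_ac)
qed

end

lemma exists_jordan_coordinates:
  assumes "mat_subspace m V" "linear_on m V \<phi>"
  shows "\<exists>\<beta> n_as. jordan_coordinates m V \<phi> \<beta> n_as"
proof -
  obtain \<beta> where "is_basis m V \<beta>" using mat_subspace_obtain_basis[OF assms(1)] .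
  from jordan_basis_exists[OF this assms(2)] show ?thesis
    using assms(2) by (auto simp: jordan_basis_def jordan_coordinates_def)
qed

locale nonnilpotent_jordan_coordinates = jordan_coordinates +
  assumes nonzero_eigenvalue: "\<exists>(k,a)\<in>jordan_indices n_as. a \<noteq> 0"
begin

abbreviation growth :: "nat \<Rightarrow> real" where
  "growth \<equiv> jordan_growth (jordan_indices n_as)"

lemma basis_nonempty: "\<beta> \<noteq> []"
  using nonzero_eigenvalue by (auto simp: basis_nonempty_iff)

lemma growth_pos: "growth n > 0"
  using nonzero_eigenvalue jordan_growth_indices_pos by blast

lemma beta_norm_funpow_eq_growth: "jordan_basis m V \<phi> \<gamma> \<Longrightarrow> beta_norm m \<gamma> (\<phi> ^^ n) = growth n"
  by (rule beta_norm_funpow[OF _ basis_nonempty])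

lemma normalised_jordan_power_cesaro_convergent:
  assumes "p < length \<beta>" "q < length \<beta>"
  shows "\<exists>L. cesaro_tendsto (\<lambda>n. (jordan_matrix n_as ^\<^sub>m n) $$ (p,q) / complex_of_real (growth n)) L"
  using jordan_matrix_pow_index_cases[of p n_as q, unfolded length_basis, OF assms]
proof (elim disjE bexE)
  assume "\<forall>n. (jordan_matrix n_as ^\<^sub>m n) $$ (p,q) = 0"
  thus ?thesis using cesaro_tendsto_const[of 0] by auto
next
  fix x assume "x \<in> jordan_indices n_as"
    "case x of (k,a) \<Rightarrow> \<forall>n. (jordan_matrix n_as ^\<^sub>m n) $$ (p,q) = jordan_entry k a n"
  thus ?thesis using nonzero_eigenvalue
    normalised_jordan_entry_cesaro_convergent[OF finite_jordan_indices] by fastforce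
qed

lemma normalised_powers_cesaro_convergent:
  "\<exists>\<psi>. (\<forall>X. X \<notin> V \<longrightarrow> \<psi> X = 0\<^sub>m m m) \<and> (\<forall>X\<in>V. \<psi> X \<in> carrier_mat m m)
     \<and> cesaro_map_tendsto m V (\<lambda>n. \<phi> ^^ n) growth \<psi>"
proof -
  obtain L where
    L: "cesaro_tendsto (\<lambda>n. (jordan_matrix n_as ^\<^sub>m n) $$ (p,q) / complex_of_real (growth n)) (L p q)"
    if "p < length \<beta>" "q < length \<beta>" for p q
    using normalised_jordan_power_cesaro_convergent by metis
  have "\<exists>l. cesaro_tendsto (\<lambda>n. (\<phi> ^^ n) X $$ (i,j) / complex_of_real (growth n)) l"
    if "X \<in> V" and ij: "i < m" "j < m" for X i j
  proof -
    obtain v where v: "v \<in> carrier_vec (length \<beta>)" "X = lincomb_vec m \<beta> v"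
      using is_basis_obtain_lincomb_vec[OF basis \<open>X \<in> V\<close>] .
    have "cesaro_tendsto (\<lambda>n. (\<phi> ^^ n) X $$ (i,j) / complex_of_real (growth n))
       (\<Sum>x\<in>{..<length \<beta>} \<times> {..<length \<beta>}. (v $ snd x * \<beta> ! fst x $$ (i,j)) * L (fst x) (snd x))"
      unfolding v(2) funpow_index_expansion[OF v(1) ij] case_prod_beta
      by (rule cesaro_tendsto_sum_divide) (auto intro: L)
    thus ?thesis by blast
  qed
  then obtain l where l: "cesaro_tendsto (\<lambda>n. (\<phi> ^^ n) X $$ (i,j) / complex_of_real (growth n)) (l X i j)"
    if "X \<in> V" "i < m" "j < m" for X i j by metis
  thus ?thesis
    by (intro exI[of _ "\<lambda>X. if X \<in> V then mat m m (\<lambda>(i,j). l X i j) else 0\<^sub>m m m"])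
      (simp add: cesaro_map_tendsto_def)
qed

lemma maximal_part_cesaro:
  "(\<forall>X\<in>V. maximal_part m V \<phi> X \<in> carrier_mat m m)
    \<and> cesaro_map_tendsto m V (\<lambda>n. \<phi> ^^ n) growth (maximal_part m V \<phi>)"
proof -
  define is_limit where "is_limit \<psi> \<longleftrightarrow> (\<forall>X. X \<notin> V \<longrightarrow> \<psi> X = 0\<^sub>m m m) \<and>
    (\<forall>X\<in>V. \<psi> X \<in> carrier_mat m m) \<and> cesaro_map_tendsto m V (\<lambda>n. \<phi> ^^ n) growth \<psi>" for \<psi>
  have "(\<forall>\<gamma>. jordan_basis m V \<phi> \<gamma> \<longrightarrow> cesaro_map_tendsto m V (\<lambda>n. \<phi> ^^ n) (\<lambda>n. beta_norm m \<gamma> (\<phi> ^^ n)) \<psi>)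
      \<longleftrightarrow> cesaro_map_tendsto m V (\<lambda>n. \<phi> ^^ n) growth \<psi>" for \<psi>
    using beta_norm_funpow_eq_growth is_jordan_basis by auto
  hence "maximal_part m V \<phi> = (THE \<psi>. is_limit \<psi>)"
    unfolding maximal_part_def is_limit_def cesaro_map_tendsto_def cesaro_tendsto_def by (simp only:)
  moreover obtain \<psi> where limit: "is_limit \<psi>"
    using normalised_powers_cesaro_convergent unfolding is_limit_def by blast
  have "\<psi>' = \<psi>" if "is_limit \<psi>'" for \<psi>'
  proof
    fix X
    show "\<psi>' X = \<psi> X"
      using that limit unfolding is_limit_def
      by (cases "X \<in> V") (auto intro: cesaro_map_tendsto_unique)
  qed
  with limit have "is_limit (THE \<psi>. is_limit \<psi>)" by (rule theI)
  ultimately show ?thesis unfolding is_limit_def by simp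
qed

end

lemma nonnilpotent_jordan_coordinates_exist:
  assumes V: "mat_subspace m V" "V \<noteq> {0\<^sub>m m m}" and lin: "linear_on m V \<phi>"
    and r: "map_spectral_radius V \<phi> > 0"
  shows "\<exists>\<beta> n_as. nonnilpotent_jordan_coordinates m V \<phi> \<beta> n_as"
proof -
  from exists_jordan_coordinates[OF V(1) lin] obtain \<beta> n_as where "jordan_coordinates m V \<phi> \<beta> n_as"
    by blast
  then interpret jordan_coordinates m V \<phi> \<beta> n_as .
  have "\<beta> \<noteq> []" using basis V(2) by (auto simp: is_basis_def mspan_def lincomb_def)
  from spectral_radius_pos_obtain_index[OF r this] obtain a where "(0,a) \<in> jordan_indices n_as" "a \<noteq> 0" .
  hence "nonnilpotent_jordan_coordinates m V \<phi> \<beta> n_as" by unfold_locales auto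
  thus ?thesis by blast
qed

lemma jordan_coordinates_append_kernel:
  assumes J: "jordan_coordinates m V \<phi> \<beta> n_as" and \<gamma>: "is_basis m W \<gamma>"
    and disjoint: "W \<inter> V \<subseteq> {0\<^sub>m m m}" and U: "U = {X + Y | X Y. X \<in> W \<and> Y \<in> V}"
    and lin: "linear_on m U \<psi>"
    and kernel: "\<And>X. X \<in> W \<Longrightarrow> \<psi> X = 0\<^sub>m m m" and agree: "\<And>Y. Y \<in> V \<Longrightarrow> \<psi> Y = \<phi> Y"
  shows "jordan_coordinates m U \<psi> (\<gamma> @ \<beta>) (replicate (length \<gamma>) (1,0) @ n_as)"
proof -
  interpret jordan_coordinates m V \<phi> \<beta> n_as by (rule J)
  have "linear_on m W \<psi>"
    using is_basis_mat_subspace[OF \<gamma>] by (auto simp: linear_on_def kernel mat_subspace_def)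
  moreover have "linear_on m V \<psi>"
    using linear is_basis_mat_subspace[OF basis] by (simp add: linear_on_def agree mat_subspace_def)
  moreover have "map_mat m \<gamma> \<psi> = 0\<^sub>m (length \<gamma>) (length \<gamma>)"
  proof (rule map_mat_eqI[OF \<gamma>])
    fix v :: "complex vec" assume v: "v \<in> carrier_vec (length \<gamma>)"
    have "0\<^sub>m (length \<gamma>) (length \<gamma>) *\<^sub>v v = 0\<^sub>v (length \<gamma>)" using v by (intro eq_vecI) auto
    thus "\<psi> (lincomb_vec m \<gamma> v) = lincomb_vec m \<gamma> (0\<^sub>m (length \<gamma>) (length \<gamma>) *\<^sub>v v)"
      using kernel[OF is_basis_lincomb_vec_mem[OF \<gamma> v]] by (simp add: lincomb_vec_zero)
  qed simp
  moreover have "map_mat m \<beta> \<psi> = jordan_matrix n_as"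
    unfolding jordan[symmetric] using agree is_basis_subset[OF basis] by (intro map_mat_cong) auto
  ultimately have "map_mat m (\<gamma> @ \<beta>) \<psi> = four_block_mat (jordan_matrix (replicate (length \<gamma>) (1,0)))
      (0\<^sub>m (length \<gamma>) (length \<beta>)) (0\<^sub>m (length \<beta>) (length \<gamma>)) (jordan_matrix n_as)"
    using map_mat_append[OF \<gamma> basis disjoint U lin] by (simp add: jordan_matrix_replicate_zero del: One_nat_def)
  also have "\<dots> = jordan_matrix (replicate (length \<gamma>) (1,0) @ n_as)"
    by (simp add: jordan_matrix_append length_basis sum_list_replicate)
  finally show ?thesis
    using is_basis_append[OF \<gamma> basis disjoint] lin unfolding U by unfold_locales
qed

lemma jordan_growth_replicate_zero_blocks:
  assumes "n \<ge> 1"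
  shows "jordan_growth (jordan_indices (replicate q (1,0) @ n_as)) n = jordan_growth (jordan_indices n_as) n"
  unfolding jordan_indices_append using assms
  by (intro jordan_growth_Un_zero_entries finite_jordan_indices)
    (auto simp: jordan_indices_def jordan_entry_def power_0_left)

section \<open>The canonical extension\<close>

lemma bd_part_carrier[simp]:
  "bd_part ns X \<in> carrier_mat (sum_list ns) (sum_list ns)"
  "dim_row (bd_part ns X) = sum_list ns" "dim_col (bd_part ns X) = sum_list ns"
  by (auto simp: bd_part_def)

lemma bd_part_mem[simp]: "bd_part ns X \<in> block_alg ns"
  by (auto simp: block_alg_def bd_part_def)

lemma bd_part_id: "X \<in> block_alg ns \<Longrightarrow> bd_part ns X = X"
  by (rule eq_matI) (auto simp: block_alg_def bd_part_def)

lemma linear_on_bd_part: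
  "linear_on (sum_list ns) (carrier_mat (sum_list ns) (sum_list ns)) (bd_part ns)"
  unfolding linear_on_def by (auto simp: bd_part_def intro!: eq_matI)

lemma mat_subspace_block_alg: "mat_subspace (sum_list ns) (block_alg ns)"
  by (auto simp: mat_subspace_def block_alg_def)

lemma block_alg_nonzero:
  assumes "sum_list ns > 0"
  shows "block_alg ns \<noteq> {0\<^sub>m (sum_list ns) (sum_list ns)}"
proof -
  have "1\<^sub>m (sum_list ns) \<noteq> (0\<^sub>m (sum_list ns) (sum_list ns) :: complex mat)"
    using assms by (auto simp: mat_eq_iff)
  moreover have "1\<^sub>m (sum_list ns) \<in> block_alg ns" by (auto simp: block_alg_def)
  ultimately show ?thesis by blast
qed

lemma carrier_mat_eq_kernel_plus_block_alg:
  fixes ns :: "nat list"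
  defines "m \<equiv> sum_list ns"
  shows "carrier_mat m m
    = {X + Y | X Y. X \<in> {X \<in> carrier_mat m m. bd_part ns X = 0\<^sub>m m m} \<and> Y \<in> block_alg ns}"
    (is "?C = ?sum")
proof (intro equalityI subsetI)
  fix X assume X: "X \<in> ?C"
  have "bd_part ns (X - bd_part ns X) = 0\<^sub>m m m"
    using X by (intro eq_matI) (auto simp: bd_part_def m_def)
  moreover have "X = (X - bd_part ns X) + bd_part ns X" "X - bd_part ns X \<in> ?C"
    using X by (auto simp: m_def intro!: eq_matI)
  ultimately show "X \<in> ?sum" using bd_part_mem by blast
qed (auto simp: block_alg_def m_def)

lemma linear_on_can_ext:
  assumes "linear_on (sum_list ns) (block_alg ns) \<tau>"
  shows "linear_on (sum_list ns) (carrier_mat (sum_list ns) (sum_list ns)) (can_ext ns \<tau>)"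
  using assms linear_on_bd_part[of ns] mat_subspace_carrier[OF mat_subspace_block_alg[of ns]]
  unfolding linear_on_def can_ext_def by auto

lemma can_ext_funpow:
  assumes lin: "linear_on (sum_list ns) (block_alg ns) \<tau>" and "n \<ge> 1"
  shows "(can_ext ns \<tau> ^^ n) X = (\<tau> ^^ n) (bd_part ns X)"
  using \<open>n \<ge> 1\<close>
proof (induction n rule: dec_induct)
  case (step n)
  thus ?case using bd_part_id[OF linear_on_funpow_mem[OF lin bd_part_mem]] by (simp add: can_ext_def)
qed (simp add: can_ext_def)

lemma can_ext_nonnilpotent_jordan_coordinates:
  assumes "nonnilpotent_jordan_coordinates (sum_list ns) (block_alg ns) \<tau> \<beta> n_as"
  shows "\<exists>\<gamma> q. nonnilpotent_jordan_coordinates (sum_list ns) (carrier_mat (sum_list ns) (sum_list ns))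
    (can_ext ns \<tau>) \<gamma> (replicate q (1,0) @ n_as)"
proof -
  let ?m = "sum_list ns" and ?C = "carrier_mat (sum_list ns) (sum_list ns)"
  interpret nonnilpotent_jordan_coordinates ?m "block_alg ns" \<tau> \<beta> n_as by (rule assms)
  define W where "W = {X \<in> ?C. bd_part ns X = 0\<^sub>m ?m ?m}"
  have "linear_on ?m ?C (bd_part ns)" by (rule linear_on_bd_part)
  hence "mat_subspace ?m W" unfolding W_def by (rule mat_subspace_kernel[OF mat_subspace_carrier_mat])
  then obtain \<delta> where \<delta>: "is_basis ?m W \<delta>" by (rule mat_subspace_obtain_basis)
  have "jordan_coordinates ?m ?C (can_ext ns \<tau>) (\<delta> @ \<beta>) (replicate (length \<delta>) (1,0) @ n_as)"
  proof (rule jordan_coordinates_append_kernel[OF jordan_coordinates_axioms \<delta>])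
    show "W \<inter> block_alg ns \<subseteq> {0\<^sub>m ?m ?m}" using bd_part_id by (auto simp: W_def)
    show "?C = {X + Y | X Y. X \<in> W \<and> Y \<in> block_alg ns}"
      unfolding W_def by (rule carrier_mat_eq_kernel_plus_block_alg)
    show "linear_on ?m ?C (can_ext ns \<tau>)" by (rule linear_on_can_ext[OF linear])
    show "can_ext ns \<tau> X = 0\<^sub>m ?m ?m" if "X \<in> W" for X
      using that linear_on_zero[OF mat_subspace_block_alg linear] by (simp add: W_def can_ext_def)
  qed (simp add: can_ext_def bd_part_id)
  moreover have "\<exists>(k,a)\<in>jordan_indices (replicate (length \<delta>) (1,0) @ n_as). a \<noteq> 0"
    using nonzero_eigenvalue by (auto simp: jordan_indices_append)
  ultimately show ?thesis
    by (blast intro: nonnilpotent_jordan_coordinates.intro nonnilpotent_jordan_coordinates_axioms.intro)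
qed

lemma can_ext_maximal_part:
  assumes \<tau>: "nonnilpotent_jordan_coordinates (sum_list ns) (block_alg ns) \<tau> \<beta> n_as"
    and X: "X \<in> carrier_mat (sum_list ns) (sum_list ns)"
  shows "can_ext ns (maximal_part (sum_list ns) (block_alg ns) \<tau>) X
    = maximal_part (sum_list ns) (carrier_mat (sum_list ns) (sum_list ns)) (can_ext ns \<tau>) X"
proof -
  let ?m = "sum_list ns" and ?C = "carrier_mat (sum_list ns) (sum_list ns)"
  interpret nonnilpotent_jordan_coordinates ?m "block_alg ns" \<tau> \<beta> n_as by (rule \<tau>)
  from can_ext_nonnilpotent_jordan_coordinates[OF \<tau>] obtain \<gamma> q where
    "nonnilpotent_jordan_coordinates ?m ?C (can_ext ns \<tau>) \<gamma> (replicate q (1,0) @ n_as)" by blast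
  then interpret ext: nonnilpotent_jordan_coordinates ?m ?C "can_ext ns \<tau>" \<gamma> "replicate q (1,0) @ n_as" .
  have "cesaro_map_tendsto ?m ?C (\<lambda>n X. (\<tau> ^^ n) (bd_part ns X)) growth
      (can_ext ns (maximal_part ?m (block_alg ns) \<tau>))"
    using maximal_part_cesaro by (simp add: cesaro_map_tendsto_def can_ext_def)
  hence "cesaro_map_tendsto ?m ?C (\<lambda>n. can_ext ns \<tau> ^^ n) ext.growth
      (can_ext ns (maximal_part ?m (block_alg ns) \<tau>))"
    by (rule cesaro_map_tendsto_cong)
      (simp_all add: can_ext_funpow[OF linear] jordan_growth_replicate_zero_blocks del: One_nat_def)
  moreover have "can_ext ns (maximal_part ?m (block_alg ns) \<tau>) X \<in> carrier_mat ?m ?m"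
    using maximal_part_cesaro by (simp add: can_ext_def)
  ultimately show ?thesis
    using ext.maximal_part_cesaro X by (intro cesaro_map_tendsto_unique[of _ ?C]) auto
qed

section \<open>The Frobenius inner product\<close>

abbreviation positions :: "nat \<Rightarrow> (nat \<times> nat) set" where
  "positions m \<equiv> {..<m} \<times> {..<m}"

definition mat_inner :: "nat \<Rightarrow> complex mat \<Rightarrow> complex mat \<Rightarrow> complex" where
  "mat_inner m A B = (\<Sum>x\<in>positions m. A $$ x * cnj (B $$ x))"

lemma mat_inner_add_left:
  assumes "A \<in> carrier_mat m m" "B \<in> carrier_mat m m"
  shows "mat_inner m (A + B) C = mat_inner m A C + mat_inner m B C"
  unfolding mat_inner_def sum.distrib[symmetric]
  using assms by (intro sum.cong) (auto simp: algebra_simps)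

lemma mat_inner_smult_left:
  assumes "A \<in> carrier_mat m m"
  shows "mat_inner m (c \<cdot>\<^sub>m A) C = c * mat_inner m A C"
  unfolding mat_inner_def sum_distrib_left using assms by (intro sum.cong) auto

lemma mat_inner_minus_left:
  assumes "A \<in> carrier_mat m m" "B \<in> carrier_mat m m"
  shows "mat_inner m (A - B) C = mat_inner m A C - mat_inner m B C"
  unfolding mat_inner_def sum_subtractf[symmetric]
  using assms by (intro sum.cong) (auto simp: algebra_simps)

lemma mat_inner_zero_left: "mat_inner m (0\<^sub>m m m) C = 0"
  by (auto simp: mat_inner_def intro!: sum.neutral)

lemma mat_inner_commute: "mat_inner m A B = cnj (mat_inner m B A)"
  by (simp add: mat_inner_def mult.commute)

lemma mat_inner_self_eq_0:
  assumes "A \<in> carrier_mat m m" "mat_inner m A A = 0"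
  shows "A = 0\<^sub>m m m"
proof -
  have "mat_inner m A A = complex_of_real (\<Sum>x\<in>positions m. (cmod (A $$ x))\<^sup>2)"
    unfolding mat_inner_def of_real_sum complex_norm_square ..
  hence "(\<Sum>x\<in>positions m. (cmod (A $$ x))\<^sup>2) = 0" using assms(2) by (metis of_real_eq_0_iff)
  hence "\<forall>x\<in>positions m. (cmod (A $$ x))\<^sup>2 = 0" by (subst (asm) sum_nonneg_eq_0_iff) auto
  thus ?thesis using assms(1) by (intro eq_matI) auto
qed

lemma mat_subspace_orthogonal: "mat_subspace m {A \<in> carrier_mat m m. mat_inner m A C = 0}"
  by (auto simp: mat_subspace_def mat_inner_add_left mat_inner_smult_left mat_inner_zero_left)

lemma mat_inner_mspan_eq_0:
  assumes "set Bs \<subseteq> carrier_mat m m" "\<And>B. B \<in> set Bs \<Longrightarrow> mat_inner m B C = 0" "A \<in> mspan m Bs"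
  shows "mat_inner m A C = 0"
  using mspan_least[OF mat_subspace_orthogonal, of Bs m C] assms by auto

text \<open>For \<open>P = 0\<close> the quotient is \<open>0 / 0 = 0\<close>, and the claim is still true.\<close>

lemma mat_inner_orthogonalised:
  assumes W: "W \<in> carrier_mat m m" and P: "P \<in> carrier_mat m m"
  shows "mat_inner m (W - (mat_inner m W P / mat_inner m P P) \<cdot>\<^sub>m P) P = 0"
proof (cases "mat_inner m P P = 0")
  case True
  hence "P = 0\<^sub>m m m" by (rule mat_inner_self_eq_0[OF P])
  thus ?thesis using mat_inner_commute[of m _ P] by (simp add: mat_inner_zero_left)
next
  case False
  thus ?thesis using W P by (simp add: mat_inner_minus_left mat_inner_smult_left)
qed

lemma orthogonal_projection_exists:
  assumes "set Bs \<subseteq> carrier_mat m m" "X \<in> carrier_mat m m"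
  shows "\<exists>W\<in>carrier_mat m m. (\<forall>B\<in>set Bs. mat_inner m W B = 0) \<and> X - W \<in> mspan m Bs"
  using assms
proof (induction Bs arbitrary: X)
  case Nil
  have "X - X = 0\<^sub>m m m" using Nil.prems by simp
  thus ?case using Nil.prems mat_subspace_mspan[of "[]" m]
    by (intro bexI[of _ X]) (auto simp: mat_subspace_zero)
next
  case (Cons B Bs)
  have B: "B \<in> carrier_mat m m" and Bs: "set Bs \<subseteq> carrier_mat m m" using Cons.prems by auto
  define V where "V = mspan m (B # Bs)"
  have V: "mat_subspace m V" unfolding V_def by (rule mat_subspace_mspan[OF Cons.prems(1)])
  have BV: "B \<in> V" and BsV: "mspan m Bs \<subseteq> V"
    using set_subset_mspan[OF Cons.prems(1)] mspan_least[OF V, of Bs] by (auto simp: V_def)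
  obtain P where P: "P \<in> carrier_mat m m" "\<forall>A\<in>set Bs. mat_inner m P A = 0" "B - P \<in> mspan m Bs"
    using Cons.IH[OF Bs B] by blast
  obtain W where W: "W \<in> carrier_mat m m" "\<forall>A\<in>set Bs. mat_inner m W A = 0" "X - W \<in> mspan m Bs"
    using Cons.IH[OF Bs Cons.prems(2)] by blast
  define c where "c = mat_inner m W P / mat_inner m P P"
  define W' where "W' = W - c \<cdot>\<^sub>m P"
  have W': "W' \<in> carrier_mat m m" and inner: "mat_inner m W' A = mat_inner m W A - c * mat_inner m P A" for A
    using W(1) P(1) by (auto simp: W'_def mat_inner_minus_left mat_inner_smult_left)
  have W'P: "mat_inner m W' P = 0"
    unfolding W'_def c_def by (rule mat_inner_orthogonalised[OF W(1) P(1)])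
  have W'Bs: "mat_inner m W' A = 0" if "A \<in> set Bs" for A using that P(2) W(2) by (simp add: inner)
  have "mat_inner m (B - P) W' = 0"
    by (rule mat_inner_mspan_eq_0[OF Bs _ P(3)]) (simp add: mat_inner_commute[of m _ W'] W'Bs)
  hence "mat_inner m W' B = 0"
    using W'P mat_inner_commute[of m B W'] mat_inner_commute[of m P W']
    by (simp add: mat_inner_minus_left[OF B P(1)])
  moreover have "X - W' \<in> V"
  proof -
    have "B - (B - P) \<in> V" by (rule mat_subspace_minus[OF V BV subsetD[OF BsV P(3)]])
    moreover have "B - (B - P) = P" using B P(1) by (intro eq_matI) auto
    ultimately have "(X - W) + c \<cdot>\<^sub>m P \<in> V"
      using W(3) BsV by (intro mat_subspace_add[OF V] mat_subspace_smult[OF V]) auto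
    moreover have "(X - W) + c \<cdot>\<^sub>m P = X - W'"
      using Cons.prems(2) W(1) P(1) by (intro eq_matI) (auto simp: W'_def)
    ultimately show ?thesis by simp
  qed
  ultimately show ?case using W' W'Bs unfolding V_def by (intro bexI[of _ W']) auto
qed

lemma mem_mat_subspaceI_orthogonal:
  assumes V: "mat_subspace m V" and X: "X \<in> carrier_mat m m"
    and orth: "\<And>W. W \<in> carrier_mat m m \<Longrightarrow> (\<And>B. B \<in> V \<Longrightarrow> mat_inner m B W = 0) \<Longrightarrow> mat_inner m X W = 0"
  shows "X \<in> V"
proof -
  obtain \<beta> where \<beta>: "is_basis m V \<beta>" by (rule mat_subspace_obtain_basis[OF V])
  have carrier: "set \<beta> \<subseteq> carrier_mat m m" and span: "mspan m \<beta> = V" using \<beta> by (auto simp: is_basis_def)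
  obtain W where W: "W \<in> carrier_mat m m" "\<forall>B\<in>set \<beta>. mat_inner m W B = 0" "X - W \<in> V"
    using orthogonal_projection_exists[OF carrier X] span by blast
  have W_orth: "mat_inner m B W = 0" if "B \<in> V" for B
    using mat_inner_mspan_eq_0[OF carrier, of W B] W(2) that span by (simp add: mat_inner_commute[of m _ W])
  have "mat_inner m W W = mat_inner m X W - mat_inner m (X - W) W"
    by (simp add: mat_inner_minus_left[OF X W(1)])
  also have "\<dots> = 0" using orth[OF W(1) W_orth] W_orth[OF W(3)] by simp
  finally have "W = 0\<^sub>m m m" by (rule mat_inner_self_eq_0[OF W(1)])
  moreover have "X - 0\<^sub>m m m = X" using X by (intro eq_matI) auto
  ultimately show ?thesis using W(3) by simp
qed

section \<open>Kraus decompositions\<close>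

definition mat_unit :: "nat \<Rightarrow> nat \<times> nat \<Rightarrow> complex mat" where
  "mat_unit m x = mat m m (\<lambda>y. if y = x then 1 else 0)"

lemma mat_unit_carrier[simp]: "mat_unit m x \<in> carrier_mat m m"
  by (simp add: mat_unit_def)

lemma mat_unit_index: "y \<in> positions m \<Longrightarrow> mat_unit m x $$ y = (if y = x then 1 else 0)"
  by (cases y) (simp add: mat_unit_def)

lemma sum_mat_unit:
  assumes "y \<in> positions m"
  shows "(\<Sum>x\<in>positions m. f x * mat_unit m x $$ y) = f y"
    and "(\<Sum>x\<in>positions m. mat_unit m y $$ x * f x) = f y"
proof -
  have "(\<Sum>x\<in>positions m. f x * mat_unit m x $$ y) = (\<Sum>x\<in>positions m. if x = y then f x else 0)"
    using assms by (intro sum.cong) (auto simp: mat_unit_index)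
  thus "(\<Sum>x\<in>positions m. f x * mat_unit m x $$ y) = f y" using assms by simp
  have "(\<Sum>x\<in>positions m. mat_unit m y $$ x * f x) = (\<Sum>x\<in>positions m. if x = y then f x else 0)"
    by (intro sum.cong) (auto simp: mat_unit_index)
  thus "(\<Sum>x\<in>positions m. mat_unit m y $$ x * f x) = f y" using assms by simp
qed

lemma mat_adjoint_carrier: "A \<in> carrier_mat n k \<Longrightarrow> mat_adjoint A \<in> carrier_mat k n"
  by (intro carrier_matI) (auto simp: mat_adjoint_def)

lemma mat_adjoint_index:
  fixes A :: "complex mat"
  assumes "A \<in> carrier_mat n k" "i < k" "j < n"
  shows "mat_adjoint A $$ (i,j) = cnj (A $$ (j,i))"
  using assms by (auto simp: mat_adjoint_def mat_of_rows_index conjugate_complex_def)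

lemma mat_adjoint_mult:
  fixes A B :: "complex mat"
  assumes A: "A \<in> carrier_mat n k" and B: "B \<in> carrier_mat k l"
  shows "mat_adjoint (A * B) = mat_adjoint B * mat_adjoint A"
proof (rule eq_matI)
  note carrier = mat_adjoint_carrier[OF A] mat_adjoint_carrier[OF B]
    mat_adjoint_carrier[OF mult_carrier_mat[OF A B]]
  show "dim_row (mat_adjoint (A * B)) = dim_row (mat_adjoint B * mat_adjoint A)"
    "dim_col (mat_adjoint (A * B)) = dim_col (mat_adjoint B * mat_adjoint A)"
    using carrier by auto
  fix i j assume "i < dim_row (mat_adjoint B * mat_adjoint A)" "j < dim_col (mat_adjoint B * mat_adjoint A)"
  hence ij: "i < l" "j < n" using carrier by auto
  have "mat_adjoint (A * B) $$ (i,j) = cnj (\<Sum>r<k. A $$ (j,r) * B $$ (r,i))"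
    using A B ij mat_adjoint_index[OF mult_carrier_mat[OF A B] ij]
    by (simp add: scalar_prod_def atLeast0LessThan)
  also have "\<dots> = (\<Sum>r<k. mat_adjoint B $$ (i,r) * mat_adjoint A $$ (r,j))"
    using ij by (simp add: mat_adjoint_index[OF A] mat_adjoint_index[OF B] mult.commute)
  also have "\<dots> = (mat_adjoint B * mat_adjoint A) $$ (i,j)"
    using carrier ij by (simp add: scalar_prod_def atLeast0LessThan)
  finally show "mat_adjoint (A * B) $$ (i,j) = (mat_adjoint B * mat_adjoint A) $$ (i,j)" .
qed

lemma mat_adjoint_sandwich_carrier:
  "A \<in> carrier_mat m m \<Longrightarrow> X \<in> carrier_mat m m \<Longrightarrow> mat_adjoint A * X * A \<in> carrier_mat m m"
  by (intro mult_carrier_mat mat_adjoint_carrier)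

lemma mat_adjoint_sandwich_index:
  assumes A: "A \<in> carrier_mat m m" and X: "X \<in> carrier_mat m m" and ij: "i < m" "j < m"
  shows "(mat_adjoint A * X * A) $$ (i,j)
    = (\<Sum>x\<in>positions m. X $$ x * (cnj (A $$ (fst x,i)) * A $$ (snd x,j)))"
proof -
  note A' = mat_adjoint_carrier[OF A]
  have "(mat_adjoint A * X * A) $$ (i,j) = (\<Sum>b<m. (mat_adjoint A * X) $$ (i,b) * A $$ (b,j))"
    using carrier_matD[OF mult_carrier_mat[OF A' X]] carrier_matD[OF A] ij
    by (simp add: scalar_prod_def atLeast0LessThan del: index_mult_mat(1) add: index_mult_mat(1)[of i _ j])
  also have "\<dots> = (\<Sum>b<m. (\<Sum>a<m. cnj (A $$ (a,i)) * X $$ (a,b)) * A $$ (b,j))"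
    using carrier_matD[OF A'] X ij
    by (intro sum.cong refl) (simp add: scalar_prod_def atLeast0LessThan mat_adjoint_index[OF A])
  also have "\<dots> = (\<Sum>b<m. \<Sum>a<m. X $$ (a,b) * (cnj (A $$ (a,i)) * A $$ (b,j)))"
    by (simp only: sum_distrib_right) (simp add: mult_ac)
  also have "\<dots> = (\<Sum>a<m. \<Sum>b<m. X $$ (a,b) * (cnj (A $$ (a,i)) * A $$ (b,j)))" by (rule sum.swap)
  finally show ?thesis by (simp add: sum.cartesian_product case_prod_beta)
qed

lemma kraus_sum_Nil: "kraus_sum m [] X = 0\<^sub>m m m"
  by (simp add: kraus_sum_def)

lemma kraus_sum_Cons: "kraus_sum m (A # As) X = mat_adjoint A * X * A + kraus_sum m As X"
  by (simp add: kraus_sum_def)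

lemma kraus_sum_carrier:
  assumes "set As \<subseteq> carrier_mat m m" "X \<in> carrier_mat m m"
  shows "kraus_sum m As X \<in> carrier_mat m m"
  using assms by (induction As) (auto simp: kraus_sum_Nil kraus_sum_Cons mat_adjoint_sandwich_carrier)

lemma kraus_sum_index:
  assumes As: "set As \<subseteq> carrier_mat m m" and X: "X \<in> carrier_mat m m" and ij: "i < m" "j < m"
  shows "kraus_sum m As X $$ (i,j)
    = (\<Sum>x\<in>positions m. X $$ x * (\<Sum>A\<leftarrow>As. cnj (A $$ (fst x,i)) * A $$ (snd x,j)))"
  using As
proof (induction As)
  case (Cons A As)
  hence A: "A \<in> carrier_mat m m" and "set As \<subseteq> carrier_mat m m" by auto
  hence "kraus_sum m (A # As) X $$ (i,j) = (mat_adjoint A * X * A) $$ (i,j) + kraus_sum m As X $$ (i,j)"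
    using carrier_matD[OF kraus_sum_carrier[OF _ X]] ij by (simp add: kraus_sum_Cons)
  thus ?case using Cons mat_adjoint_sandwich_index[OF A X ij] by (simp add: sum.distrib distrib_left)
qed (use ij in \<open>simp add: kraus_sum_Nil\<close>)

lemma is_kraus_carrier: "is_kraus m F As \<Longrightarrow> X \<in> carrier_mat m m \<Longrightarrow> F X \<in> carrier_mat m m"
  unfolding is_kraus_def by (simp add: kraus_sum_carrier)

lemma is_kraus_mat_unit:
  assumes "is_kraus m F As" and "x \<in> positions m" "i < m" "j < m"
  shows "F (mat_unit m x) $$ (i,j) = (\<Sum>A\<leftarrow>As. cnj (A $$ (fst x,i)) * A $$ (snd x,j))"
  using assms kraus_sum_index[of As m "mat_unit m x" i j] unfolding is_kraus_def
  by (simp add: sum_mat_unit(2) del: mem_Sigma_iff)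

lemma is_kraus_expand:
  assumes F: "is_kraus m F As" and X: "X \<in> carrier_mat m m" and ij: "i < m" "j < m"
  shows "F X $$ (i,j) = (\<Sum>x\<in>positions m. F (mat_unit m x) $$ (i,j) * X $$ x)"
proof -
  have "F X $$ (i,j) = (\<Sum>x\<in>positions m. X $$ x * (\<Sum>A\<leftarrow>As. cnj (A $$ (fst x,i)) * A $$ (snd x,j)))"
    using F X ij kraus_sum_index[of As m X i j] by (simp add: is_kraus_def)
  also have "\<dots> = (\<Sum>x\<in>positions m. F (mat_unit m x) $$ (i,j) * X $$ x)"
    using ij by (intro sum.cong refl) (simp add: is_kraus_mat_unit[OF F] mult.commute)
  finally show ?thesis .
qed

lemma is_kraus_linear_on:
  assumes F: "is_kraus m F As"
  shows "linear_on m (carrier_mat m m) F"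
  unfolding linear_on_def
proof (intro conjI ballI allI)
  fix X Y :: "complex mat" and a b assume X: "X \<in> carrier_mat m m" and Y: "Y \<in> carrier_mat m m"
  have "F (a \<cdot>\<^sub>m X + b \<cdot>\<^sub>m Y) $$ (i,j) = a * F X $$ (i,j) + b * F Y $$ (i,j)" if "i < m" "j < m" for i j
  proof -
    have "F (a \<cdot>\<^sub>m X + b \<cdot>\<^sub>m Y) $$ (i,j)
        = (\<Sum>x\<in>positions m. F (mat_unit m x) $$ (i,j) * (a \<cdot>\<^sub>m X + b \<cdot>\<^sub>m Y) $$ x)"
      using X Y by (intro is_kraus_expand[OF F _ that]) auto
    also have "\<dots> = (\<Sum>x\<in>positions m. a * (F (mat_unit m x) $$ (i,j) * X $$ x)
        + b * (F (mat_unit m x) $$ (i,j) * Y $$ x))"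
      using X Y by (intro sum.cong) (auto simp: algebra_simps)
    finally show ?thesis
      by (simp add: is_kraus_expand[OF F X that] is_kraus_expand[OF F Y that] sum.distrib sum_distrib_left)
  qed
  thus "F (a \<cdot>\<^sub>m X + b \<cdot>\<^sub>m Y) = a \<cdot>\<^sub>m F X + b \<cdot>\<^sub>m F Y"
    using is_kraus_carrier[OF F] X Y carrier_matD[OF is_kraus_carrier[OF F]] by (intro eq_matI) auto
qed (rule is_kraus_carrier[OF F])

lemma kraus_sum_append:
  assumes "set As \<subseteq> carrier_mat m m" "set Bs \<subseteq> carrier_mat m m" "X \<in> carrier_mat m m"
  shows "kraus_sum m (As @ Bs) X = kraus_sum m As X + kraus_sum m Bs X"
  using assms(1)
proof (induction As)
  case Nil
  show ?case using kraus_sum_carrier[OF assms(2,3)] by (simp add: kraus_sum_Nil)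
next
  case (Cons A As)
  thus ?case
    using kraus_sum_carrier[OF assms(2,3)] kraus_sum_carrier[of As m X]
      mat_adjoint_sandwich_carrier[of A m X] assms(3)
    by (simp add: kraus_sum_Cons assoc_add_mat[of _ m m])
qed

lemma kraus_sum_sandwich:
  assumes A: "A \<in> carrier_mat m m" and X: "X \<in> carrier_mat m m" and "set Bs \<subseteq> carrier_mat m m"
  shows "mat_adjoint A * kraus_sum m Bs X * A = kraus_sum m (map (\<lambda>B. B * A) Bs) X"
  using assms(3)
proof (induction Bs)
  case Nil
  show ?case using A mat_adjoint_carrier[OF A] by (simp add: kraus_sum_Nil)
next
  case (Cons B Bs)
  hence B: "B \<in> carrier_mat m m" and Bs: "set Bs \<subseteq> carrier_mat m m" by auto
  note A' = mat_adjoint_carrier[OF A] and B' = mat_adjoint_carrier[OF B]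
  note Y = kraus_sum_carrier[OF Bs X] and BXB = mat_adjoint_sandwich_carrier[OF B X]
  have "mat_adjoint A * kraus_sum m (B # Bs) X * A
      = mat_adjoint A * (mat_adjoint B * X * B) * A + mat_adjoint A * kraus_sum m Bs X * A"
    unfolding kraus_sum_Cons using A A' Y BXB
    by (simp add: mult_add_distrib_mat[of _ m m] add_mult_distrib_mat[of _ m m])
  also have "mat_adjoint A * (mat_adjoint B * X * B) * A = mat_adjoint (B * A) * X * (B * A)"
    unfolding mat_adjoint_mult[OF B A] using A A' B B' X
    by (simp add: assoc_mult_mat[of _ m m _ m _ m])
  finally show ?case using Cons.IH[OF Bs] by (simp add: kraus_sum_Cons)
qed

lemma is_kraus_comp:
  assumes F: "is_kraus m F As" and G: "is_kraus m G Bs"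
  shows "is_kraus m (F \<circ> G) (concat (map (\<lambda>A. map (\<lambda>B. B * A) Bs) As))"
proof -
  have Bs: "set Bs \<subseteq> carrier_mat m m" using G by (simp add: is_kraus_def)
  have carrier: "set (concat (map (\<lambda>A. map (\<lambda>B. B * A) Bs) Cs)) \<subseteq> carrier_mat m m"
    if "set Cs \<subseteq> carrier_mat m m" for Cs
    using that Bs by auto (meson mult_carrier_mat subsetD)
  have "kraus_sum m Cs (kraus_sum m Bs X) = kraus_sum m (concat (map (\<lambda>A. map (\<lambda>B. B * A) Bs) Cs)) X"
    if "set Cs \<subseteq> carrier_mat m m" "X \<in> carrier_mat m m" for Cs X
    using that(1)
  proof (induction Cs)
    case (Cons C Cs)
    have "set (map (\<lambda>B. B * C) Bs) \<subseteq> carrier_mat m m" using Cons.prems Bs by auto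
    thus ?case using Cons that(2) Bs carrier[of Cs]
      by (simp add: kraus_sum_Cons kraus_sum_append kraus_sum_sandwich del: set_map set_concat)
  qed (simp add: kraus_sum_Nil)
  thus ?thesis using F G carrier[of As] unfolding is_kraus_def by (auto simp: kraus_sum_carrier)
qed

lemma is_kraus_funpow:
  assumes T: "is_kraus m T As" and S: "subalg m S" "set As \<subseteq> S" and "n \<ge> 1"
  shows "\<exists>Ws. is_kraus m (T ^^ n) Ws \<and> set Ws \<subseteq> S"
  using \<open>n \<ge> 1\<close>
proof (induction n rule: dec_induct)
  case base
  have "T ^^ 1 = T" by (simp add: fun_eq_iff)
  thus ?case using T S(2) by auto
next
  case (step n)
  then obtain Ws where Ws: "is_kraus m (T ^^ n) Ws" "set Ws \<subseteq> S" by blast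
  have "set (concat (map (\<lambda>A. map (\<lambda>B. B * A) Ws) As)) \<subseteq> S"
    using S Ws(2) unfolding subalg_def by auto blast
  moreover have "T ^^ Suc n = T \<circ> T ^^ n" by simp
  ultimately show ?case using is_kraus_comp[OF T Ws(1)] by metis
qed

section \<open>The Choi form\<close>

text \<open>The quadratic form of the Choi matrix of \<open>F\<close>, that is of the block matrix with blocks \<open>F(E\<^sub>a\<^sub>b)\<close>;
  taking the real part loses nothing for a map with a Kraus decomposition, whose Choi matrix is positive
  semidefinite.\<close>

definition choi_form :: "nat \<Rightarrow> (complex mat \<Rightarrow> complex mat) \<Rightarrow> complex mat \<Rightarrow> real" where
  "choi_form m F v = Re (\<Sum>x\<in>positions m. \<Sum>y\<in>positions m.
     v $$ x * cnj (v $$ y) * F (mat_unit m (fst x, fst y)) $$ (snd x, snd y))"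

definition choi_trace :: "nat \<Rightarrow> (complex mat \<Rightarrow> complex mat) \<Rightarrow> real" where
  "choi_trace m F = (\<Sum>x\<in>positions m. choi_form m F (mat_unit m x))"

lemma sum_sum_list_swap:
  fixes f :: "'a \<Rightarrow> 'b \<Rightarrow> 'c :: comm_monoid_add"
  shows "(\<Sum>x\<in>S. \<Sum>A\<leftarrow>As. f x A) = (\<Sum>A\<leftarrow>As. \<Sum>x\<in>S. f x A)"
  by (induction As) (auto simp: sum.distrib)

lemma choi_form_kraus:
  assumes F: "is_kraus m F As"
  shows "choi_form m F v = (\<Sum>A\<leftarrow>As. (cmod (mat_inner m A v))\<^sup>2)"
proof -
  let ?P = "positions m" and ?t = "\<lambda>A x y. (v $$ x * cnj (A $$ x)) * (A $$ y * cnj (v $$ y))"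
  have "v $$ x * cnj (v $$ y) * F (mat_unit m (fst x, fst y)) $$ (snd x, snd y) = (\<Sum>A\<leftarrow>As. ?t A x y)"
    if "x \<in> ?P" "y \<in> ?P" for x y
  proof -
    have "F (mat_unit m (fst x, fst y)) $$ (snd x, snd y) = (\<Sum>A\<leftarrow>As. cnj (A $$ x) * A $$ y)"
      using that by (subst is_kraus_mat_unit[OF F]) auto
    thus ?thesis by (simp add: sum_list_const_mult[symmetric] mult_ac)
  qed
  hence "(\<Sum>x\<in>?P. \<Sum>y\<in>?P. v $$ x * cnj (v $$ y) * F (mat_unit m (fst x, fst y)) $$ (snd x, snd y))
      = (\<Sum>A\<leftarrow>As. \<Sum>x\<in>?P. \<Sum>y\<in>?P. ?t A x y)"
    by (simp add: sum_sum_list_swap)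
  also have "\<dots> = (\<Sum>A\<leftarrow>As. complex_of_real ((cmod (mat_inner m A v))\<^sup>2))"
  proof (rule arg_cong[of _ _ sum_list], rule map_cong[OF refl])
    fix A
    have "(\<Sum>x\<in>?P. \<Sum>y\<in>?P. ?t A x y) = (\<Sum>x\<in>?P. v $$ x * cnj (A $$ x)) * mat_inner m A v"
      unfolding mat_inner_def by (rule sum_product[symmetric])
    also have "(\<Sum>x\<in>?P. v $$ x * cnj (A $$ x)) = cnj (mat_inner m A v)"
      by (simp add: mat_inner_def mult.commute)
    also have "cnj (mat_inner m A v) * mat_inner m A v = complex_of_real ((cmod (mat_inner m A v))\<^sup>2)"
      unfolding complex_norm_square by (rule mult.commute)
    finally show "(\<Sum>x\<in>?P. \<Sum>y\<in>?P. ?t A x y) = complex_of_real ((cmod (mat_inner m A v))\<^sup>2)" .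
  qed
  also have "\<dots> = complex_of_real (\<Sum>A\<leftarrow>As. (cmod (mat_inner m A v))\<^sup>2)" by (induction As) auto
  finally show ?thesis unfolding choi_form_def by (simp only: Re_complex_of_real)
qed

lemma choi_form_nonneg: "is_kraus m F As \<Longrightarrow> choi_form m F v \<ge> 0"
  by (auto simp: choi_form_kraus intro!: sum_list_nonneg)

lemma choi_form_eq_0_iff:
  assumes F: "is_kraus m F As"
  shows "choi_form m F v = 0 \<longleftrightarrow> (\<forall>A\<in>set As. mat_inner m A v = 0)"
  unfolding choi_form_kraus[OF F] by (subst sum_list_nonneg_eq_0_iff) auto

lemma kraus_operators_subset:
  assumes F: "is_kraus m F As" and V: "mat_subspace m V"
    and form: "\<And>v. (\<And>B. B \<in> V \<Longrightarrow> mat_inner m B v = 0) \<Longrightarrow> choi_form m F v = 0"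
  shows "set As \<subseteq> V"
proof
  fix A assume A: "A \<in> set As"
  show "A \<in> V"
  proof (rule mem_mat_subspaceI_orthogonal[OF V])
    show "A \<in> carrier_mat m m" using F A by (auto simp: is_kraus_def)
    show "mat_inner m A W = 0" if "\<And>B. B \<in> V \<Longrightarrow> mat_inner m B W = 0" for W
      using form[OF that] choi_form_eq_0_iff[OF F] A by blast
  qed
qed

lemma cesaro_choi_form:
  assumes "cesaro_map_tendsto m (carrier_mat m m) F D G"
  shows "cesaro_tendsto (\<lambda>n. choi_form m (F n) v / D n) (choi_form m G v)"
proof -
  have "cesaro_tendsto (\<lambda>n. (\<Sum>y\<in>positions m.
        v $$ x * cnj (v $$ y) * F n (mat_unit m (fst x, fst y)) $$ (snd x, snd y)) / complex_of_real (D n))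
      (\<Sum>y\<in>positions m. v $$ x * cnj (v $$ y) * G (mat_unit m (fst x, fst y)) $$ (snd x, snd y))"
    if "x \<in> positions m" for x
    using that by (intro cesaro_tendsto_sum_divide cesaro_map_tendstoD[OF assms]) auto
  from cesaro_tendsto_Re[OF cesaro_tendsto_sum[OF this]] show ?thesis
    by (simp add: choi_form_def sum_divide_distrib)
qed

lemma cesaro_choi_trace:
  assumes "cesaro_map_tendsto m (carrier_mat m m) F D G"
  shows "cesaro_tendsto (\<lambda>n. choi_trace m (F n) / D n) (choi_trace m G)"
  unfolding choi_trace_def sum_divide_distrib
  by (intro cesaro_tendsto_sum cesaro_choi_form[OF assms])

section \<open>Domination by the Choi trace\<close>

lemma choi_trace_kraus:
  assumes F: "is_kraus m F As"
  shows "choi_trace m F = (\<Sum>A\<leftarrow>As. \<Sum>x\<in>positions m. (cmod (A $$ x))\<^sup>2)"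
proof -
  have "mat_inner m A (mat_unit m x) = A $$ x" if "x \<in> positions m" for A x
  proof -
    have "mat_inner m A (mat_unit m x) = (\<Sum>y\<in>positions m. mat_unit m x $$ y * A $$ y)"
      unfolding mat_inner_def by (intro sum.cong refl) (auto simp: mat_unit_index)
    thus ?thesis using sum_mat_unit(2)[OF that] by simp
  qed
  thus ?thesis unfolding choi_trace_def choi_form_kraus[OF F] by (simp add: sum_sum_list_swap)
qed

lemma choi_trace_nonneg: "is_kraus m F As \<Longrightarrow> choi_trace m F \<ge> 0"
  unfolding choi_trace_def by (intro sum_nonneg choi_form_nonneg)

lemma norm_sum_list_le:
  fixes f :: "'a \<Rightarrow> 'b :: real_normed_vector"
  assumes "\<And>x. x \<in> set xs \<Longrightarrow> norm (f x) \<le> g x"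
  shows "norm (\<Sum>x\<leftarrow>xs. f x) \<le> (\<Sum>x\<leftarrow>xs. g x)"
  using assms by (induction xs) (auto intro!: norm_triangle_le add_mono)

lemma norm_kraus_mat_unit_le:
  assumes F: "is_kraus m F As" and x: "x \<in> positions m" and y: "y \<in> positions m"
  shows "cmod (F (mat_unit m x) $$ y) \<le> choi_trace m F"
proof -
  obtain i j where ij: "y = (i,j)" "i < m" "j < m" using y by auto
  have "cmod (cnj (A $$ (fst x,i)) * A $$ (snd x,j)) \<le> (\<Sum>z\<in>positions m. (cmod (A $$ z))\<^sup>2)" for A
  proof -
    let ?s = "\<Sum>z\<in>positions m. (cmod (A $$ z))\<^sup>2"
    have entry_le: "(cmod (A $$ z))\<^sup>2 \<le> ?s" if "z \<in> positions m" for z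
      using that by (intro member_le_sum) auto
    have "2 * cmod (A $$ (fst x,i)) * cmod (A $$ (snd x,j))
        \<le> (cmod (A $$ (fst x,i)))\<^sup>2 + (cmod (A $$ (snd x,j)))\<^sup>2"
      by (rule sum_squares_bound)
    also have "\<dots> \<le> 2 * ?s" using entry_le[of "(fst x,i)"] entry_le[of "(snd x,j)"] x ij by auto
    finally show ?thesis by (simp add: norm_mult)
  qed
  thus ?thesis
    unfolding ij(1) is_kraus_mat_unit[OF F x ij(2,3)] choi_trace_kraus[OF F] by (intro norm_sum_list_le)
qed

lemma coords_expand:
  assumes basis: "is_basis m (carrier_mat m m) \<gamma>" and X: "X \<in> carrier_mat m m" and p: "p < length \<gamma>"
  shows "coords m \<gamma> X ! p = (\<Sum>x\<in>positions m. X $$ x * coords m \<gamma> (mat_unit m x) ! p)"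
proof -
  have "\<exists>v. v \<in> carrier_vec (length \<gamma>) \<and> mat_unit m x = lincomb_vec m \<gamma> v" for x
    using is_basis_obtain_lincomb_vec[OF basis mat_unit_carrier] by blast
  then obtain w where w: "w x \<in> carrier_vec (length \<gamma>)" "mat_unit m x = lincomb_vec m \<gamma> (w x)" for x
    by metis
  define u where "u = vec (length \<gamma>) (\<lambda>p. \<Sum>x\<in>positions m. X $$ x * w x $ p)"
  have "X = lincomb_vec m \<gamma> u"
  proof (rule eq_matI)
    fix i j assume "i < dim_row (lincomb_vec m \<gamma> u)" "j < dim_col (lincomb_vec m \<gamma> u)"
    hence ij: "i < m" "j < m" by auto
    have "lincomb_vec m \<gamma> u $$ (i,j) = (\<Sum>p<length \<gamma>. \<Sum>x\<in>positions m. X $$ x * (w x $ p * \<gamma> ! p $$ (i,j)))"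
      using ij by (simp add: u_def entry_vec_def scalar_prod_def atLeast0LessThan sum_distrib_right mult.assoc)
    also have "\<dots> = (\<Sum>x\<in>positions m. \<Sum>p<length \<gamma>. X $$ x * (w x $ p * \<gamma> ! p $$ (i,j)))" by (rule sum.swap)
    also have "\<dots> = (\<Sum>x\<in>positions m. X $$ x * mat_unit m x $$ (i,j))"
      using ij by (simp add: w(2) entry_vec_def scalar_prod_def atLeast0LessThan sum_distrib_left)
    also have "\<dots> = X $$ (i,j)" using ij by (intro sum_mat_unit(1)) auto
    finally show "X $$ (i,j) = lincomb_vec m \<gamma> u $$ (i,j)" by simp
  qed (use X in auto)
  moreover have "u \<in> carrier_vec (length \<gamma>)" by (simp add: u_def)
  ultimately have "coords m \<gamma> X ! p = u $ p"
    using coords_lincomb_vec[OF basis] by (metis list_of_vec_index)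
  also have "\<dots> = (\<Sum>x\<in>positions m. X $$ x * coords m \<gamma> (mat_unit m x) ! p)"
    using p by (simp add: u_def w(2) coords_lincomb_vec[OF basis w(1)] list_of_vec_index)
  finally show ?thesis .
qed

lemma norm_map_mat_kraus_le:
  assumes basis: "is_basis m (carrier_mat m m) \<gamma>" and F: "is_kraus m F As"
    and pq: "p < length \<gamma>" "q < length \<gamma>"
  shows "cmod (map_mat m \<gamma> F $$ (p,q)) \<le> (\<Sum>y\<in>positions m. \<Sum>x\<in>positions m.
    cmod (\<gamma> ! q $$ x) * cmod (coords m \<gamma> (mat_unit m y) ! p)) * choi_trace m F"
proof -
  have \<gamma>q: "\<gamma> ! q \<in> carrier_mat m m" using is_basis_carrier[OF basis] pq(2) by auto
  have "map_mat m \<gamma> F $$ (p,q) = coords m \<gamma> (F (\<gamma> ! q)) ! p" using pq by (simp add: map_mat_def)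
  also have "\<dots> = (\<Sum>y\<in>positions m. F (\<gamma> ! q) $$ y * coords m \<gamma> (mat_unit m y) ! p)"
    by (rule coords_expand[OF basis is_kraus_carrier[OF F \<gamma>q] pq(1)])
  also have "\<dots> = (\<Sum>y\<in>positions m. \<Sum>x\<in>positions m.
      F (mat_unit m x) $$ y * \<gamma> ! q $$ x * coords m \<gamma> (mat_unit m y) ! p)"
    using is_kraus_expand[OF F \<gamma>q] by (intro sum.cong refl) (auto simp: sum_distrib_right)
  also have "cmod \<dots> \<le> (\<Sum>y\<in>positions m. \<Sum>x\<in>positions m.
      cmod (\<gamma> ! q $$ x) * cmod (coords m \<gamma> (mat_unit m y) ! p) * choi_trace m F)"
  proof (intro sum_norm_le)
    fix y x assume "y \<in> positions m" "x \<in> positions m"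
    hence "cmod (F (mat_unit m x) $$ y) \<le> choi_trace m F" by (intro norm_kraus_mat_unit_le[OF F])
    hence "cmod (F (mat_unit m x) $$ y) * (cmod (\<gamma> ! q $$ x) * cmod (coords m \<gamma> (mat_unit m y) ! p))
        \<le> choi_trace m F * (cmod (\<gamma> ! q $$ x) * cmod (coords m \<gamma> (mat_unit m y) ! p))"
      by (rule mult_right_mono) simp
    thus "cmod (F (mat_unit m x) $$ y * \<gamma> ! q $$ x * coords m \<gamma> (mat_unit m y) ! p)
        \<le> cmod (\<gamma> ! q $$ x) * cmod (coords m \<gamma> (mat_unit m y) ! p) * choi_trace m F"
      by (simp add: norm_mult mult_ac)
  qed
  finally show ?thesis by (simp add: sum_distrib_right)
qed

lemma beta_norm_le_choi_trace:
  assumes basis: "is_basis m (carrier_mat m m) \<gamma>" "\<gamma> \<noteq> []"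
  shows "\<exists>C>0. \<forall>F As. is_kraus m F As \<longrightarrow> beta_norm m \<gamma> F \<le> C * choi_trace m F"
proof -
  define c where "c p q = (\<Sum>y\<in>positions m. \<Sum>x\<in>positions m.
    cmod (\<gamma> ! q $$ x) * cmod (coords m \<gamma> (mat_unit m y) ! p))" for p q
  define C where "C = Max ((\<lambda>(p,q). c p q) ` positions (length \<gamma>))"
  have c_le: "c p q \<le> C" if "p < length \<gamma>" "q < length \<gamma>" for p q
    unfolding C_def using that by (intro Max_ge) auto
  have "beta_norm m \<gamma> F \<le> max 1 C * choi_trace m F" if F: "is_kraus m F As" for F As
    unfolding beta_norm_le_iff[OF basis(2)] norm_bound_def map_mat_dim
  proof (intro allI impI)
    fix p q assume pq: "p < length \<gamma>" "q < length \<gamma>"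
    have "cmod (map_mat m \<gamma> F $$ (p,q)) \<le> c p q * choi_trace m F"
      unfolding c_def by (rule norm_map_mat_kraus_le[OF basis(1) F pq])
    also have "\<dots> \<le> max 1 C * choi_trace m F"
      using c_le[OF pq] by (intro mult_right_mono choi_trace_nonneg[OF F]) simp
    finally show "cmod (map_mat m \<gamma> F $$ (p,q)) \<le> max 1 C * choi_trace m F" .
  qed
  thus ?thesis by (intro exI[of _ "max 1 C"]) auto
qed

section \<open>Ideals in generated algebras\<close>

lemma subalg_mat_subspace: "subalg m S \<Longrightarrow> mat_subspace m S"
  by (simp add: subalg_def mat_subspace_def)

lemma subalg_gen_alg:
  assumes "set As \<subseteq> carrier_mat m m"
  shows "subalg m (gen_alg m As)" "set As \<subseteq> gen_alg m As"
proof -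
  have "subalg m (carrier_mat m m)" by (auto simp: subalg_def)
  hence "gen_alg m As \<subseteq> carrier_mat m m" using assms unfolding gen_alg_def by blast
  thus "subalg m (gen_alg m As)" unfolding subalg_def gen_alg_def by auto
  show "set As \<subseteq> gen_alg m As" unfolding gen_alg_def by auto
qed

lemma gen_alg_least: "subalg m S \<Longrightarrow> set As \<subseteq> S \<Longrightarrow> gen_alg m As \<subseteq> S"
  unfolding gen_alg_def by blast

lemma is_ideal_subalg:
  assumes "is_ideal m I S" "subalg m S"
  shows "subalg m I"
  using assms by (auto simp: is_ideal_def subalg_def subset_iff)

definition idealizer :: "nat \<Rightarrow> complex mat set \<Rightarrow> complex mat set" where
  "idealizer m V = {Y \<in> carrier_mat m m. \<forall>Z\<in>V. Y * Z \<in> V \<and> Z * Y \<in> V}"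

lemma subalg_idealizer:
  assumes V: "mat_subspace m V"
  shows "subalg m (idealizer m V)"
  unfolding subalg_def
proof (intro conjI ballI allI)
  note carrier = mat_subspace_carrier[OF V]
  have "0\<^sub>m m m * Z = 0\<^sub>m m m" "Z * 0\<^sub>m m m = 0\<^sub>m m m" if "Z \<in> V" for Z
    using carrier[OF that] by auto
  thus "0\<^sub>m m m \<in> idealizer m V" using mat_subspace_zero[OF V] by (simp add: idealizer_def)
  fix X Y assume X: "X \<in> idealizer m V" and Y: "Y \<in> idealizer m V"
  hence XY: "X \<in> carrier_mat m m" "Y \<in> carrier_mat m m" by (auto simp: idealizer_def)
  have "(X + Y) * Z \<in> V \<and> Z * (X + Y) \<in> V" if Z: "Z \<in> V" for Z
    unfolding add_mult_distrib_mat[OF XY carrier[OF Z]] mult_add_distrib_mat[OF carrier[OF Z] XY]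
    using X Y Z by (auto simp: idealizer_def intro: mat_subspace_add[OF V])
  thus "X + Y \<in> idealizer m V" using XY by (simp add: idealizer_def)
  have "X * Y * Z \<in> V \<and> Z * (X * Y) \<in> V" if Z: "Z \<in> V" for Z
    unfolding assoc_mult_mat[OF XY carrier[OF Z]] assoc_mult_mat[OF carrier[OF Z] XY, symmetric]
    using X Y Z by (auto simp: idealizer_def)
  thus "X * Y \<in> idealizer m V" using XY by (simp add: idealizer_def)
next
  fix a X assume X: "X \<in> idealizer m V"
  hence X_carrier: "X \<in> carrier_mat m m" by (auto simp: idealizer_def)
  have "(a \<cdot>\<^sub>m X) * Z \<in> V \<and> Z * (a \<cdot>\<^sub>m X) \<in> V" if Z: "Z \<in> V" for Z
    unfolding mult_smult_assoc_mat[OF X_carrier mat_subspace_carrier[OF V Z]]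
      mult_smult_distrib[OF mat_subspace_carrier[OF V Z] X_carrier]
    using X Z by (auto simp: idealizer_def intro: mat_subspace_smult[OF V])
  thus "a \<cdot>\<^sub>m X \<in> idealizer m V" using X_carrier by (simp add: idealizer_def)
qed (auto simp: idealizer_def)

lemma mem_idealizer_mspan:
  assumes A: "A \<in> carrier_mat m m" and Bs: "set Bs \<subseteq> carrier_mat m m"
    and products: "\<And>B. B \<in> set Bs \<Longrightarrow> A * B \<in> mspan m Bs \<and> B * A \<in> mspan m Bs"
  shows "A \<in> idealizer m (mspan m Bs)"
proof -
  note V = mat_subspace_mspan[OF Bs]
  define Z where "Z = {Y \<in> carrier_mat m m. A * Y \<in> mspan m Bs \<and> Y * A \<in> mspan m Bs}"
  have "mat_subspace m Z" unfolding mat_subspace_def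
  proof (intro conjI ballI allI)
    show "0\<^sub>m m m \<in> Z" using A mat_subspace_zero[OF V] by (auto simp: Z_def)
    fix X Y assume X: "X \<in> Z" and Y: "Y \<in> Z"
    hence XY: "X \<in> carrier_mat m m" "Y \<in> carrier_mat m m" by (auto simp: Z_def)
    thus "X + Y \<in> Z"
      using X Y mat_subspace_add[OF V] add_mult_distrib_mat[OF XY A] mult_add_distrib_mat[OF A XY]
      by (simp add: Z_def)
  next
    fix a X assume X: "X \<in> Z"
    hence X_carrier: "X \<in> carrier_mat m m" by (simp add: Z_def)
    thus "a \<cdot>\<^sub>m X \<in> Z"
      using X mat_subspace_smult[OF V] mult_smult_assoc_mat[OF X_carrier A] mult_smult_distrib[OF A X_carrier]
      by (simp add: Z_def)
  qed (auto simp: Z_def)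
  moreover have "set Bs \<subseteq> Z" using Bs products by (auto simp: Z_def)
  ultimately have "mspan m Bs \<subseteq> Z" by (rule mspan_least)
  thus ?thesis using A by (auto simp: Z_def idealizer_def)
qed

lemma is_ideal_mspan_gen_algI:
  assumes As: "set As \<subseteq> carrier_mat m m" and Bs: "set Bs \<subseteq> gen_alg m As"
    and products: "\<And>A B. A \<in> set As \<Longrightarrow> B \<in> set Bs \<Longrightarrow> A * B \<in> mspan m Bs \<and> B * A \<in> mspan m Bs"
  shows "is_ideal m (mspan m Bs) (gen_alg m As)"
proof -
  note alg = subalg_gen_alg[OF As]
  have Bs_carrier: "set Bs \<subseteq> carrier_mat m m" using Bs alg(1) by (auto simp: subalg_def)
  note V = mat_subspace_mspan[OF Bs_carrier]
  have "set As \<subseteq> idealizer m (mspan m Bs)"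
    using As products mem_idealizer_mspan[OF _ Bs_carrier] by blast
  hence "gen_alg m As \<subseteq> idealizer m (mspan m Bs)" by (rule gen_alg_least[OF subalg_idealizer[OF V]])
  moreover have "mspan m Bs \<subseteq> gen_alg m As" by (rule mspan_least[OF subalg_mat_subspace[OF alg(1)] Bs])
  ultimately show ?thesis using V by (auto simp: is_ideal_def idealizer_def mat_subspace_def)
qed

section \<open>Kraus operators of the maximal part\<close>

lemma cesaro_map_tendsto_comp_left:
  assumes T: "is_kraus m T As" and lim: "cesaro_map_tendsto m (carrier_mat m m) F D \<psi>"
    and carrier: "\<And>n X. X \<in> carrier_mat m m \<Longrightarrow> F n X \<in> carrier_mat m m \<and> \<psi> X \<in> carrier_mat m m"
  shows "cesaro_map_tendsto m (carrier_mat m m) (\<lambda>n. T \<circ> F n) D (T \<circ> \<psi>)"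
  unfolding cesaro_map_tendsto_def
proof (intro ballI allI impI)
  fix X :: "complex mat" and i j assume X: "X \<in> carrier_mat m m" and ij: "i < m" "j < m"
  have "cesaro_tendsto (\<lambda>n. (\<Sum>x\<in>positions m. T (mat_unit m x) $$ (i,j) * F n X $$ x) / complex_of_real (D n))
      (\<Sum>x\<in>positions m. T (mat_unit m x) $$ (i,j) * \<psi> X $$ x)"
    by (rule cesaro_tendsto_sum_divide) (auto intro: cesaro_map_tendstoD[OF lim X])
  thus "cesaro_tendsto (\<lambda>n. (T \<circ> F n) X $$ (i,j) / complex_of_real (D n)) ((T \<circ> \<psi>) X $$ (i,j))"
    unfolding o_apply
      is_kraus_expand[OF T conjunct1[OF carrier[OF X]] ij]
      is_kraus_expand[OF T conjunct2[OF carrier[OF X]] ij] .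
qed

lemma cesaro_map_tendsto_comp_right:
  assumes "cesaro_map_tendsto m V F D \<psi>" "\<And>X. X \<in> V \<Longrightarrow> T X \<in> V"
  shows "cesaro_map_tendsto m V (\<lambda>n. F n \<circ> T) D (\<psi> \<circ> T)"
  using assms by (simp add: cesaro_map_tendsto_def)

locale normalised_kraus_powers =
  fixes m :: nat and T :: "complex mat \<Rightarrow> complex mat" and As :: "complex mat list"
    and \<gamma> :: "complex mat list" and \<psi> :: "complex mat \<Rightarrow> complex mat" and Bs :: "complex mat list"
  assumes T: "is_kraus m T As" and \<psi>: "is_kraus m \<psi> Bs"
    and basis: "is_basis m (carrier_mat m m) \<gamma>" "\<gamma> \<noteq> []"
    and power_norm_pos: "\<And>n. beta_norm m \<gamma> (T ^^ n) > 0"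
    and limit: "cesaro_map_tendsto m (carrier_mat m m) (\<lambda>n. T ^^ n) (\<lambda>n. beta_norm m \<gamma> (T ^^ n)) \<psi>"
begin

abbreviation power_norm :: "nat \<Rightarrow> real" where
  "power_norm n \<equiv> beta_norm m \<gamma> (T ^^ n)"

lemma As_carrier: "set As \<subseteq> carrier_mat m m" and Bs_carrier: "set Bs \<subseteq> carrier_mat m m"
  using T \<psi> by (auto simp: is_kraus_def)

lemma power_kraus_in_gen_alg:
  assumes "n \<ge> 1"
  obtains Ws where "is_kraus m (T ^^ n) Ws" "set Ws \<subseteq> gen_alg m As"
  using is_kraus_funpow[OF T subalg_gen_alg[OF As_carrier] assms] by blast

lemma power_norm_Suc_le: "power_norm (Suc n) \<le> beta_norm m \<gamma> T * length \<gamma> * power_norm n"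
  using beta_norm_comp_le[OF basis is_kraus_linear_on[OF T] linear_on_funpow[OF is_kraus_linear_on[OF T]], of n]
  by (simp add: mult_ac)

lemma Bs_subset_gen_alg: "set Bs \<subseteq> gen_alg m As"
proof (rule kraus_operators_subset[OF \<psi> subalg_mat_subspace[OF subalg_gen_alg(1)[OF As_carrier]]])
  fix v assume orth: "\<And>B. B \<in> gen_alg m As \<Longrightarrow> mat_inner m B v = 0"
  have "choi_form m (T ^^ n) v = 0" if "n \<ge> 1" for n
    using power_kraus_in_gen_alg[OF that] choi_form_eq_0_iff orth by (metis subsetD)
  hence "eventually (\<lambda>n. 0 = choi_form m (T ^^ n) v / power_norm n) sequentially"
    by (intro eventually_sequentiallyI[of 1]) simp
  hence "cesaro_tendsto (\<lambda>n. 0) (choi_form m \<psi> v)"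
    by (rule cesaro_tendsto_eventually_cong[OF cesaro_choi_form[OF limit]])
  thus "choi_form m \<psi> v = 0" by (rule cesaro_tendsto_unique[OF _ cesaro_tendsto_const])
qed

lemma shifted_limit_choi_form_le:
  assumes G: "cesaro_map_tendsto m (carrier_mat m m) (\<lambda>n. T ^^ Suc n) power_norm G"
  shows "choi_form m G v \<le> beta_norm m \<gamma> T * length \<gamma> * choi_form m \<psi> v"
proof (rule cesaro_tendsto_le[OF cesaro_choi_form[OF G]
      cesaro_tendsto_mult_left[OF cesaro_tendsto_Suc[OF cesaro_choi_form[OF limit]]]])
  fix n :: nat assume "n \<ge> 1"
  let ?K = "beta_norm m \<gamma> T * length \<gamma>" and ?f = "choi_form m (T ^^ Suc n) v"
  have "?f \<ge> 0" using power_kraus_in_gen_alg[of "Suc n"] choi_form_nonneg by (metis le_add1 plus_1_eq_Suc)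
  moreover have "1 / power_norm n \<le> ?K / power_norm (Suc n)"
    using power_norm_Suc_le[of n] power_norm_pos[of n] power_norm_pos[of "Suc n"]
    by (simp add: field_simps del: funpow.simps)
  ultimately show "?f / power_norm n \<le> ?K * (?f / power_norm (Suc n))"
    using mult_left_mono[of "1 / power_norm n" "?K / power_norm (Suc n)" ?f]
    by (simp add: mult_ac del: funpow.simps)
qed

lemma shifted_limit_kraus_subset:
  assumes G: "is_kraus m G Cs"
    and "cesaro_map_tendsto m (carrier_mat m m) (\<lambda>n. T ^^ Suc n) power_norm G"
  shows "set Cs \<subseteq> mspan m Bs"
proof (rule kraus_operators_subset[OF G mat_subspace_mspan[OF Bs_carrier]])
  fix v assume "\<And>B. B \<in> mspan m Bs \<Longrightarrow> mat_inner m B v = 0"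
  hence "choi_form m \<psi> v = 0" using choi_form_eq_0_iff[OF \<psi>] set_subset_mspan[OF Bs_carrier] by blast
  thus "choi_form m G v = 0"
    using shifted_limit_choi_form_le[OF assms(2), of v] choi_form_nonneg[OF G, of v] by simp
qed

lemma products_in_span:
  assumes "A \<in> set As" "B \<in> set Bs"
  shows "A * B \<in> mspan m Bs \<and> B * A \<in> mspan m Bs"
proof
  have "cesaro_map_tendsto m (carrier_mat m m) (\<lambda>n. T ^^ Suc n) power_norm (\<psi> \<circ> T)"
    unfolding funpow_Suc_right by (rule cesaro_map_tendsto_comp_right[OF limit is_kraus_carrier[OF T]])
  from shifted_limit_kraus_subset[OF is_kraus_comp[OF \<psi> T] this]
  show "A * B \<in> mspan m Bs" using assms by auto
  have "cesaro_map_tendsto m (carrier_mat m m) (\<lambda>n. T ^^ Suc n) power_norm (T \<circ> \<psi>)"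
    unfolding funpow.simps
    by (rule cesaro_map_tendsto_comp_left[OF T limit])
      (use linear_on_funpow_mem[OF is_kraus_linear_on[OF T]] is_kraus_carrier[OF \<psi>] in blast)
  from shifted_limit_kraus_subset[OF is_kraus_comp[OF T \<psi>] this]
  show "B * A \<in> mspan m Bs" using assms by auto
qed

lemma is_ideal_span: "is_ideal m (mspan m Bs) (gen_alg m As)"
  by (rule is_ideal_mspan_gen_algI[OF As_carrier Bs_subset_gen_alg products_in_span])

lemma span_nonzero: "mspan m Bs \<noteq> {0\<^sub>m m m}"
proof
  assume "mspan m Bs = {0\<^sub>m m m}"
  hence "B = 0\<^sub>m m m" if "B \<in> set Bs" for B using set_subset_mspan[OF Bs_carrier] that by auto
  hence "choi_form m \<psi> v = 0" for v using choi_form_eq_0_iff[OF \<psi>] mat_inner_zero_left by metis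
  hence trace_0: "choi_trace m \<psi> = 0" by (simp add: choi_trace_def)
  obtain C where C: "C > 0" "\<And>F As. is_kraus m F As \<Longrightarrow> beta_norm m \<gamma> F \<le> C * choi_trace m F"
    using beta_norm_le_choi_trace[OF basis] by blast
  have "1 / C \<le> choi_trace m \<psi>"
  proof (rule cesaro_tendsto_le[OF cesaro_tendsto_const cesaro_choi_trace[OF limit]])
    fix n :: nat assume "n \<ge> 1"
    then obtain Ws where "is_kraus m (T ^^ n) Ws" by (rule power_kraus_in_gen_alg)
    from C(2)[OF this] show "1 / C \<le> choi_trace m (T ^^ n) / power_norm n"
      using C(1) power_norm_pos[of n] by (simp add: field_simps)
  qed
  thus False using C(1) trace_0 by simp
qed

end

lemma is_kraus_maximal_part_ideal:
  assumes "nonnilpotent_jordan_coordinates m (carrier_mat m m) T \<gamma> n_as"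
    and T: "is_kraus m T As" and maximal: "is_kraus m (maximal_part m (carrier_mat m m) T) Bs"
  shows "subalg m (mspan m Bs) \<and> is_ideal m (mspan m Bs) (gen_alg m As) \<and> mspan m Bs \<noteq> {0\<^sub>m m m}"
proof -
  interpret nonnilpotent_jordan_coordinates m "carrier_mat m m" T \<gamma> n_as by (rule assms(1))
  interpret normalised_kraus_powers m T As \<gamma> "maximal_part m (carrier_mat m m) T" Bs
    by unfold_locales
      (use T maximal basis basis_nonempty growth_pos maximal_part_cesaro
        beta_norm_funpow_eq_growth[OF is_jordan_basis]
        in simp_all)
  show ?thesis
    using is_ideal_span span_nonzero is_ideal_subalg subalg_gen_alg(1)[OF As_carrier] by blast
qed

theorem theorem5p15:
  fixes ns :: "nat list" and m :: nat and \<tau> :: "complex mat \<Rightarrow> complex mat"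
  assumes ns: "ns \<noteq> []" "\<forall>n\<in>set ns. 0 < n"
    and m: "m = sum_list ns"
    and cp: "completely_positive_on m (block_alg ns) \<tau>"
    and r: "map_spectral_radius (block_alg ns) \<tau> > 0"
  shows "(\<forall>X\<in>carrier_mat m m.
            can_ext ns (maximal_part m (block_alg ns) \<tau>) X
            = maximal_part m (carrier_mat m m) (can_ext ns \<tau>) X)
      \<and> (\<forall>As Bs. is_kraus m (can_ext ns \<tau>) As
              \<longrightarrow> is_kraus m (can_ext ns (maximal_part m (block_alg ns) \<tau>)) Bs
              \<longrightarrow> subalg m (mspan m Bs)
                \<and> is_ideal m (mspan m Bs) (gen_alg m As)
                \<and> mspan m Bs \<noteq> {0\<^sub>m m m})"
proof -
  have "m > 0" using ns m by (cases ns) auto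
  hence "block_alg ns \<noteq> {0\<^sub>m m m}" unfolding m by (rule block_alg_nonzero)
  moreover have "linear_on m (block_alg ns) \<tau>" using cp by (simp add: completely_positive_on_def)
  ultimately obtain \<beta> n_as where \<tau>: "nonnilpotent_jordan_coordinates m (block_alg ns) \<tau> \<beta> n_as"
    using nonnilpotent_jordan_coordinates_exist mat_subspace_block_alg r unfolding m by blast
  from can_ext_nonnilpotent_jordan_coordinates[OF \<tau>[unfolded m]] obtain \<gamma> q
    where ext: "nonnilpotent_jordan_coordinates m (carrier_mat m m) (can_ext ns \<tau>) \<gamma> (replicate q (1,0) @ n_as)"
    unfolding m by blast
  have commutes: "can_ext ns (maximal_part m (block_alg ns) \<tau>) X
      = maximal_part m (carrier_mat m m) (can_ext ns \<tau>) X"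
    if "X \<in> carrier_mat m m" for X
    using can_ext_maximal_part[OF \<tau>[unfolded m]] that unfolding m by blast
  hence "is_kraus m (can_ext ns (maximal_part m (block_alg ns) \<tau>)) Bs
      \<longleftrightarrow> is_kraus m (maximal_part m (carrier_mat m m) (can_ext ns \<tau>)) Bs" for Bs
    by (simp add: is_kraus_def)
  with commutes is_kraus_maximal_part_ideal[OF ext] show ?thesis by blast
qed

end
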